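(* Let $G$ be a Cohen-Macaulay bipartite graph and let $P$ be the finite poset such that $\mathcal{C}_{P,2}=G$. Then, for every $i\ge 0$, $$\beta_i(I(G)^* )=\sum_{\alpha \in \mathbb{I}(P)}\binom{|\mathrm{Max}(\alpha)|}{i}.$$
   Context: Let $\mathbb{k}$ be a field. For a finite simple graph $G$ with vertices regarded as variables of a polynomial ring $T$ over $\mathbb{k}$, the edge ideal $I(G)\subseteq T$ is generated by the products $xy$ with $\{x,y\}$ an edge of $G$, and $G$ is called Cohen-Macaulay if $T/I(G)$ is Cohen-Macaulay. $I(G)^*$ is the Alexander dual (cover ideal) of $I(G)$: the ideal of $T$ generated by the monomials $\prod_{x\in W}x$ with $W$ a vertex cover of $G$, i.e. a set of vertices meeting every edge. For a finite poset $P=\{p_1,\dots,p_n\}$, labelled so that $p_i<p_j$ implies $i<j$, $\mathcal{C}_{P,2}$ is the bipartite graph with vertex set $\{x_{1j},x_{2j}:1\le j\le n\}$ and edges $\{x_{1j_1},x_{2j_2}\}$ for all pairs with $p_{j_1}\le p_{j_2}$ in $P$. (By a theorem of Herzog and Hibi, every Cohen-Macaulay bipartite graph is of this form for some poset $P$.) A poset ideal of $P$ is a subset $\alpha\subseteq P$ such that $p\in\alpha$, $q\in P$, $q\le p$ imply $q\in\alpha$; $\mathbb{I}(P)$ is the set of all poset ideals of $P$ (including $\emptyset$ and $P$), and $\mathrm{Max}(\alpha)$ is the set of maximal elements of $\alpha$ with respect to the induced order (so $\mathrm{Max}(\emptyset)=\emptyset$). $|\cdot|$ denotes cardinality. $\beta_i(I)=\dim_{\mathbb{k}}\mathrm{Tor}^T_i(I,\mathbb{k})$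 is the $i$-th total Betti number of a monomial ideal $I\subseteq T$. *)

theory Defs
  imports
    "HOL-Library.Poly_Mapping"
    "HOL-Library.Extended_Nat"
    "HOL-Algebra.QuotRing"
    "HOL-Algebra.Ring_Divisibility"
    "Jordan_Normal_Form.Matrix_Kernel"
begin

type_synonym ('v, 'k) mpoly = "('v \<Rightarrow>\<^sub>0 nat) \<Rightarrow>\<^sub>0 'k"

text \<open>The ring \<open>T\<close> of polynomials whose variables lie in \<open>V\<close>, inside the ring of all polynomials
  with variables from the type \<open>'v\<close>.\<close>

definition poly_ring :: "'v set \<Rightarrow> ('v, 'k::field) mpoly ring" where
  "poly_ring V = class_ring
     \<lparr> carrier := {f. \<forall>m \<in> Poly_Mapping.keys f. Poly_Mapping.keys m \<subseteq> V} \<rparr>"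

definition var :: "'v \<Rightarrow> ('v, 'k::field) mpoly" where
  "var x = Poly_Mapping.single (Poly_Mapping.single x 1) 1"

text \<open>A Noetherian ring is Cohen-Macaulay if the depth of every maximal ideal equals its
  height. This is Eisenbud's formulation, equivalent to all localizations at maximal ideals
  being Cohen-Macaulay local rings. The depth of an ideal is the supremum of the lengths of the
  regular sequences contained in it.\<close>

definition regular_sequence :: "('a, 'b) ring_scheme \<Rightarrow> 'a list \<Rightarrow> bool" where
  "regular_sequence R xs \<longleftrightarrow>
     set xs \<subseteq> carrier R \<and> genideal R (set xs) \<noteq> carrier R \<and>
     (\<forall>i < length xs. \<forall>a \<in> carrier R.
        a \<otimes>\<^bsub>R\<^esub> xs ! i \<in> genideal R (set (take i xs)) \<longrightarrow> a \<in> genideal R (set (take i xs)))"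

definition ideal_depth :: "('a, 'b) ring_scheme \<Rightarrow> 'a set \<Rightarrow> enat" where
  "ideal_depth R J = Sup {enat (length xs) | xs. regular_sequence R xs \<and> set xs \<subseteq> J}"

definition prime_height :: "('a, 'b) ring_scheme \<Rightarrow> 'a set \<Rightarrow> enat" where
  "prime_height R Q = Sup {enat n | n.
     \<exists>c :: nat \<Rightarrow> 'a set. (\<forall>i \<le> n. primeideal (c i) R) \<and> (\<forall>i < n. c i \<subset> c (Suc i)) \<and> c n = Q}"

definition cohen_macaulay_ring :: "('a, 'b) ring_scheme \<Rightarrow> bool" where
  "cohen_macaulay_ring R \<longleftrightarrow>
     cring R \<and> noetherian_ring R \<and> (\<forall>M. maximalideal M R \<longrightarrow> ideal_depth R M = prime_height R M)"

definition simple_graph :: "'v set \<Rightarrow> 'v set set \<Rightarrow> bool" where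
  "simple_graph V E \<longleftrightarrow> finite V \<and> (\<forall>e \<in> E. e \<subseteq> V \<and> card e = 2)"

definition bipartite_graph :: "'v set \<Rightarrow> 'v set set \<Rightarrow> bool" where
  "bipartite_graph V E \<longleftrightarrow>
     (\<exists>A B. A \<union> B = V \<and> A \<inter> B = {} \<and> (\<forall>e \<in> E. e \<inter> A \<noteq> {} \<and> e \<inter> B \<noteq> {}))"

definition graph_isomorphic ::
    "'v set \<Rightarrow> 'v set set \<Rightarrow> 'w set \<Rightarrow> 'w set set \<Rightarrow> bool" where
  "graph_isomorphic V E V' E' \<longleftrightarrow> (\<exists>\<phi>. bij_betw \<phi> V V' \<and> E' = (\<lambda>e. \<phi> ` e) ` E)"

definition vertex_cover :: "'v set \<Rightarrow> 'v set set \<Rightarrow> 'v set \<Rightarrow> bool" where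
  "vertex_cover V E W \<longleftrightarrow> W \<subseteq> V \<and> (\<forall>e \<in> E. e \<inter> W \<noteq> {})"

definition edge_ideal :: "'v set \<Rightarrow> 'v set set \<Rightarrow> ('v, 'k::field) mpoly set" where
  "edge_ideal V E = genideal (poly_ring V) {var x * var y | x y. {x, y} \<in> E}"

definition cover_ideal :: "'v set \<Rightarrow> 'v set set \<Rightarrow> ('v, 'k::field) mpoly set" where
  "cover_ideal V E = genideal (poly_ring V) {\<Prod>x\<in>W. var x | W. vertex_cover V E W}"

definition cohen_macaulay_graph :: "'k::field itself \<Rightarrow> 'v set \<Rightarrow> 'v set set \<Rightarrow> bool" where
  "cohen_macaulay_graph k V E \<longleftrightarrow>
     cohen_macaulay_ring (poly_ring V Quot (edge_ideal V E :: ('v, 'k) mpoly set))"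

definition poly_vec :: "'v set \<Rightarrow> nat \<Rightarrow> ('v, 'k::field) mpoly vec set" where
  "poly_vec V n = {v \<in> carrier_vec n. \<forall>i < n. v $ i \<in> carrier (poly_ring V)}"

definition poly_mat :: "'v set \<Rightarrow> nat \<Rightarrow> nat \<Rightarrow> ('v, 'k::field) mpoly mat set" where
  "poly_mat V m n = {A \<in> carrier_mat m n. \<forall>i < m. \<forall>j < n. A $$ (i, j) \<in> carrier (poly_ring V)}"

text \<open>A resolution \<open>\<dots> \<rightarrow> F\<^sub>1 \<rightarrow> F\<^sub>0 \<rightarrow> I \<rightarrow> 0\<close> of an ideal \<open>I\<close> of \<open>T\<close> by free \<open>T\<close>-modules of finite rank
  is given by matrices: \<open>F\<^sub>n\<close> is \<open>T\<close> to the power \<open>dim_col (d n)\<close>, the one-row matrix \<open>d 0\<close> is the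
  augmentation \<open>F\<^sub>0 \<rightarrow> T\<close> with image \<open>I\<close>, and \<open>d (Suc n)\<close> is the differential from
  \<open>F\<close> in degree \<open>Suc n\<close> to \<open>F\<close> in degree \<open>n\<close>.\<close>

definition free_resolution ::
    "'v set \<Rightarrow> ('v, 'k::field) mpoly set \<Rightarrow> (nat \<Rightarrow> ('v, 'k) mpoly mat) \<Rightarrow> bool" where
  "free_resolution V I d \<longleftrightarrow>
     d 0 \<in> poly_mat V 1 (dim_col (d 0)) \<and>
     (\<forall>n. d (Suc n) \<in> poly_mat V (dim_col (d n)) (dim_col (d (Suc n)))) \<and>
     {(d 0 *\<^sub>v v) $ 0 | v. v \<in> poly_vec V (dim_col (d 0))} = I \<and>
     (\<forall>n. {v \<in> poly_vec V (dim_col (d n)). d n *\<^sub>v v = 0\<^sub>v (dim_row (d n))} =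
          {d (Suc n) *\<^sub>v w | w. w \<in> poly_vec V (dim_col (d (Suc n)))})"

definition quotient_module :: "('a, 'm, 'c) module_scheme \<Rightarrow> 'm set \<Rightarrow> ('a, 'm set) module" where
  "quotient_module M N =
     \<lparr> carrier = a_rcosets\<^bsub>M\<^esub> N,
       mult = undefined,
       one = undefined,
       zero = N,
       add = set_add M,
       smult = (\<lambda>c X. \<Union>x\<in>X. N +>\<^bsub>M\<^esub> (c \<odot>\<^bsub>M\<^esub> x)) \<rparr>"

text \<open>The \<open>T\<close>-module \<open>\<k>\<close> is \<open>T\<close> modulo the ideal of all variables, so the residue map \<open>T \<rightarrow> \<k>\<close>
  takes constant terms. Hence tensoring a free module of rank \<open>r\<close> with \<open>\<k>\<close> gives the
  \<open>\<k>\<close>-space of vectors of length \<open>r\<close>, and tensoring the differentials replaces the entries of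
  their matrices by the constant terms. The augmentation \<open>d 0\<close> is not part of the tensored complex.\<close>

definition residue_mat :: "('v, 'k::field) mpoly mat \<Rightarrow> 'k mat" where
  "residue_mat A = map_mat (\<lambda>f. Poly_Mapping.lookup f 0) A"

definition tor_cycles :: "(nat \<Rightarrow> ('v, 'k::field) mpoly mat) \<Rightarrow> nat \<Rightarrow> 'k vec set" where
  "tor_cycles d i =
     (if i = 0 then carrier_vec (dim_col (d 0)) else mat_kernel (residue_mat (d i)))"

definition tor_boundaries :: "(nat \<Rightarrow> ('v, 'k::field) mpoly mat) \<Rightarrow> nat \<Rightarrow> 'k vec set" where
  "tor_boundaries d i =
     {residue_mat (d (Suc i)) *\<^sub>v w | w. w \<in> carrier_vec (dim_col (d (Suc i)))}"

definition tor :: "(nat \<Rightarrow> ('v, 'k::field) mpoly mat) \<Rightarrow> nat \<Rightarrow> ('k, 'k vec set) module" where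
  "tor d i = quotient_module
     (module_vec TYPE('k) (dim_col (d i)) \<lparr> carrier := tor_cycles d i \<rparr>) (tor_boundaries d i)"

text \<open>For finite \<open>V\<close> the ring \<open>T\<close> is Noetherian, so every ideal has a resolution by free modules of
  finite rank, and \<open>Tor\<close> does not depend, up to isomorphism, on the chosen one.\<close>

definition betti :: "'v set \<Rightarrow> ('v, 'k::field) mpoly set \<Rightarrow> nat \<Rightarrow> nat" where
  "betti V I i =
     vectorspace.dim class_ring (tor (SOME d. free_resolution V I d) i)"

definition order_labelling :: "'p set \<Rightarrow> ('p \<times> 'p) set \<Rightarrow> nat \<Rightarrow> (nat \<Rightarrow> 'p) \<Rightarrow> bool" where
  "order_labelling P r n p \<longleftrightarrow>
     bij_betw p {1..n} P \<and>
     (\<forall>i \<in> {1..n}. \<forall>j \<in> {1..n}. (p i, p j) \<in> r \<and> p i \<noteq> p j \<longrightarrow> i < j)"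

text \<open>The vertex named \<open>x\<close> with indices \<open>i\<close> and \<open>j\<close> is the pair \<open>(i, j)\<close>.\<close>

definition CP2_verts :: "nat \<Rightarrow> (nat \<times> nat) set" where
  "CP2_verts n = {1, 2} \<times> {1..n}"

definition CP2_edges :: "('p \<times> 'p) set \<Rightarrow> nat \<Rightarrow> (nat \<Rightarrow> 'p) \<Rightarrow> (nat \<times> nat) set set" where
  "CP2_edges r n p =
     {{(1, j1), (2, j2)} | j1 j2. j1 \<in> {1..n} \<and> j2 \<in> {1..n} \<and> (p j1, p j2) \<in> r}"

definition poset_ideals :: "'p set \<Rightarrow> ('p \<times> 'p) set \<Rightarrow> 'p set set" where
  "poset_ideals P r = {\<alpha>. \<alpha> \<subseteq> P \<and> (\<forall>p \<in> \<alpha>. \<forall>q \<in> P. (q, p) \<in> r \<longrightarrow> q \<in> \<alpha>)}"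

definition max_elems :: "('p \<times> 'p) set \<Rightarrow> 'p set \<Rightarrow> 'p set" where
  "max_elems r \<alpha> = {p \<in> \<alpha>. \<forall>q \<in> \<alpha>. (p, q) \<in> r \<longrightarrow> q = p}"

end

theory Submission
  imports Defs
begin

text \<open>The minimal vertex covers of the bipartite graph correspond to the poset ideals, so the cover
  ideal has one minimal generator for each element of the distributive lattice of ideals. The pairs of an
  ideal \<open>\<alpha>\<close> and a subset of its maximal elements are the Boolean intervals of this lattice with top
  \<open>\<alpha>\<close>, that is, the cubes of a cubical complex. Labelled with the least common multiples of the
  generators at their vertices, these cubes support a free resolution: in each multidegree the
  complex, filtered by the top ideal, has simplices as its graded pieces. The resolution is minimal
  because distinct faces carry distinct labels, and \<open>Tor\<close> can be computed from it since any two free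
  resolutions are homotopy equivalent.\<close>

section \<open>The polynomial ring and residues of matrices\<close>

text \<open>The binomial coefficients arise because removing any set of maximal elements from an
  ideal leaves an ideal: the cubes of dimension \<open>i\<close> with top \<alpha> are given by the
  \<open>i\<close>-subsets of the maxima of \<alpha>. The label of such a cube involves the first
  variables at \<alpha> and the second variables at the complement of \<alpha> and at the chosen
  subset. Hence, for a fixed admissible top, the label divides a given monomial as soon as the
  subset lies in a fixed set B, and the cubes with this top are all faces of one simplex, the empty
  face included. The delicate case is the simplex without vertices, which is not acyclic. It occurs
  for at most one ideal, the one generated by the elements outside B, and there the augmentation
  takes care of it. Since \<open>betti\<close> refers to an unspecified resolution, the comparison
  with the cubes is carried out for an arbitrary one, down to an isomorphism between cycles modulo
  boundaries and a coordinate space.\<close>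

lemma in_poly_ring_iff:
  "f \<in> carrier (poly_ring V) \<longleftrightarrow> (\<forall>m \<in> Poly_Mapping.keys f. Poly_Mapping.keys m \<subseteq> V)"
  by (simp add: poly_ring_def)

lemma poly_ring_simps:
  "add (poly_ring V) = (+)" "mult (poly_ring V) = (*)"
  "one (poly_ring V) = 1" "zero (poly_ring V) = 0"
  by (simp_all add: poly_ring_def class_ring_simps)

lemma poly_ring_zero: "0 \<in> carrier (poly_ring V)"
  by (simp add: in_poly_ring_iff)

lemma poly_ring_one: "1 \<in> carrier (poly_ring V)"
  by (simp add: in_poly_ring_iff)

lemma poly_ring_uminus: "f \<in> carrier (poly_ring V) \<Longrightarrow> - f \<in> carrier (poly_ring V)"
  by (simp add: in_poly_ring_iff in_keys_iff)

lemma poly_ring_add: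
  "f \<in> carrier (poly_ring V) \<Longrightarrow> g \<in> carrier (poly_ring V) \<Longrightarrow> f + g \<in> carrier (poly_ring V)"
  using keys_add[of f g] by (fastforce simp: in_poly_ring_iff)

lemma poly_ring_minus:
  "f \<in> carrier (poly_ring V) \<Longrightarrow> g \<in> carrier (poly_ring V) \<Longrightarrow> f - g \<in> carrier (poly_ring V)"
  using poly_ring_add[OF _ poly_ring_uminus, of f V g] by simp

lemma poly_ring_mult:
  assumes "f \<in> carrier (poly_ring V)" "g \<in> carrier (poly_ring V)"
  shows "f * g \<in> carrier (poly_ring V)"
  unfolding in_poly_ring_iff
proof
  fix m assume "m \<in> Poly_Mapping.keys (f * g)"
  then obtain a b where ab: "a \<in> Poly_Mapping.keys f" "b \<in> Poly_Mapping.keys g" "m = a + b"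
    using keys_mult[of f g] by blast
  then show "Poly_Mapping.keys m \<subseteq> V"
    using assms keys_add[of a b] by (fastforce simp: in_poly_ring_iff)
qed

lemma poly_ring_sum:
  "(\<And>x. x \<in> X \<Longrightarrow> f x \<in> carrier (poly_ring V)) \<Longrightarrow> sum f X \<in> carrier (poly_ring V)"
  by (induction X rule: infinite_finite_induct) (auto intro: poly_ring_zero poly_ring_add)

lemma poly_ring_single:
  "Poly_Mapping.keys m \<subseteq> V \<Longrightarrow> Poly_Mapping.single m c \<in> carrier (poly_ring V)"
  by (simp add: in_poly_ring_iff)

lemma lookup_single_times_add:
  fixes f :: "'a::cancel_comm_monoid_add \<Rightarrow>\<^sub>0 'b::semiring_0"
  shows "Poly_Mapping.lookup (Poly_Mapping.single v c * f) (v + l) = c * Poly_Mapping.lookup f l"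
proof -
  have "Poly_Mapping.lookup (Poly_Mapping.single v c * f) (v + l) =
      Sum_any (\<lambda>k. Poly_Mapping.lookup (Poly_Mapping.single v c) k *
        Sum_any (\<lambda>q. Poly_Mapping.lookup f q when v + l = k + q))"
    by (rule lookup_mult)
  also have "\<dots> = Sum_any (\<lambda>k. c * Sum_any (\<lambda>q. Poly_Mapping.lookup f q when v + l = v + q) when v = k)"
    by (intro Sum_any.cong) (auto simp: lookup_single when_def)
  also have "\<dots> = c * Sum_any (\<lambda>q. Poly_Mapping.lookup f q when l = q)"
    by simp
  finally show ?thesis
    by simp
qed

lemma lookup_single_times_not_add:
  fixes f :: "'a::cancel_comm_monoid_add \<Rightarrow>\<^sub>0 'b::semiring_0"
  assumes "\<And>l. m \<noteq> v + l"
  shows "Poly_Mapping.lookup (Poly_Mapping.single v c * f) m = 0"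
proof -
  have "Poly_Mapping.lookup (Poly_Mapping.single v c * f) m =
      Sum_any (\<lambda>k. Poly_Mapping.lookup (Poly_Mapping.single v c) k *
        Sum_any (\<lambda>q. Poly_Mapping.lookup f q when m = k + q))"
    by (rule lookup_mult)
  also have "\<dots> = Sum_any (\<lambda>k. c * Sum_any (\<lambda>q. Poly_Mapping.lookup f q when m = v + q) when v = k)"
    by (intro Sum_any.cong) (auto simp: lookup_single when_def)
  also have "\<dots> = 0"
    using assms by simp
  finally show ?thesis .
qed

text \<open>Exponents cannot cancel, so the constant term of a product only sees the constant terms
  of the factors. This makes taking constant terms a homomorphism and lets
  \<open>residue_mat\<close> commute with matrix products.\<close>

lemma exponent_add_eq_0_iff:
  fixes a b :: "'v \<Rightarrow>\<^sub>0 nat"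
  shows "0 = a + b \<longleftrightarrow> a = 0 \<and> b = 0"
  by (auto simp: poly_mapping_eq_iff lookup_add fun_eq_iff)

lemma lookup_mult_0:
  fixes f g :: "('v \<Rightarrow>\<^sub>0 nat) \<Rightarrow>\<^sub>0 'b::semiring_0"
  shows "Poly_Mapping.lookup (f * g) 0 = Poly_Mapping.lookup f 0 * Poly_Mapping.lookup g 0"
proof -
  have "Poly_Mapping.lookup (f * g) 0 =
      Sum_any (\<lambda>l. Poly_Mapping.lookup f l * Sum_any (\<lambda>q. Poly_Mapping.lookup g q when 0 = l + q))"
    by (rule lookup_mult)
  also have "\<dots> = Sum_any (\<lambda>l :: 'v \<Rightarrow>\<^sub>0 nat. Poly_Mapping.lookup f 0 * Poly_Mapping.lookup g 0 when 0 = l)"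
  proof (intro Sum_any.cong)
    fix l :: "'v \<Rightarrow>\<^sub>0 nat"
    have "Sum_any (\<lambda>q. Poly_Mapping.lookup g q when 0 = l + q) =
        (if l = 0 then Sum_any (\<lambda>q. Poly_Mapping.lookup g q when q = 0) else 0)"
      unfolding exponent_add_eq_0_iff by auto
    then show "Poly_Mapping.lookup f l * Sum_any (\<lambda>q. Poly_Mapping.lookup g q when 0 = l + q) =
        (Poly_Mapping.lookup f 0 * Poly_Mapping.lookup g 0 when 0 = l)"
      by (auto simp: when_def)
  qed
  finally show ?thesis
    by simp
qed

lemma semiring_hom_residue:
  "semiring_hom (\<lambda>f :: ('v, 'k::field) mpoly. Poly_Mapping.lookup f 0)"
  by unfold_locales (simp_all add: lookup_add lookup_mult_0)

lemma residue_mat_mult: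
  "A \<in> carrier_mat a b \<Longrightarrow> B \<in> carrier_mat b c \<Longrightarrow>
    residue_mat (A * B) = residue_mat A * residue_mat B"
  unfolding residue_mat_def by (rule semiring_hom.mat_hom_mult[OF semiring_hom_residue])

lemma residue_mat_carrier [simp]: "A \<in> carrier_mat a b \<Longrightarrow> residue_mat A \<in> carrier_mat a b"
  by (simp add: residue_mat_def)

lemma dim_residue_mat [simp]:
  "dim_row (residue_mat A) = dim_row A" "dim_col (residue_mat A) = dim_col A"
  by (simp_all add: residue_mat_def)

lemma residue_mat_one: "residue_mat (1\<^sub>m a :: ('v, 'k::field) mpoly mat) = 1\<^sub>m a"
  by (auto simp: residue_mat_def lookup_one when_def intro!: eq_matI)

lemma residue_mat_zero: "residue_mat (0\<^sub>m a b :: ('v, 'k::field) mpoly mat) = 0\<^sub>m a b"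
  by (auto simp: residue_mat_def intro!: eq_matI)

lemma residue_mat_minus:
  "A \<in> carrier_mat a b \<Longrightarrow> B \<in> carrier_mat a b \<Longrightarrow>
    residue_mat (A - B) = residue_mat A - residue_mat B"
  by (auto simp: residue_mat_def lookup_minus intro!: eq_matI)

lemma poly_mat_carrier: "A \<in> poly_mat V m n \<Longrightarrow> A \<in> carrier_mat m n"
  by (simp add: poly_mat_def)

lemma poly_mat_mult:
  assumes "A \<in> poly_mat V a b" "B \<in> poly_mat V b c"
  shows "A * B \<in> poly_mat V a c"
  using assms by (auto simp: poly_mat_def scalar_prod_def intro!: poly_ring_sum poly_ring_mult)

lemma poly_mat_minus:
  "A \<in> poly_mat V a b \<Longrightarrow> B \<in> poly_mat V a b \<Longrightarrow> A - B \<in> poly_mat V a b"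
  by (auto simp: poly_mat_def intro!: poly_ring_minus)

lemma poly_mat_one: "1\<^sub>m a \<in> poly_mat V a a"
  by (auto simp: poly_mat_def poly_ring_zero poly_ring_one)

lemma poly_mat_mult_vec:
  assumes "A \<in> poly_mat V a b" "v \<in> poly_vec V b"
  shows "A *\<^sub>v v \<in> poly_vec V a"
  using assms
  by (auto simp: poly_mat_def poly_vec_def scalar_prod_def intro!: poly_ring_sum poly_ring_mult)

lemma poly_mat_col: "A \<in> poly_mat V a b \<Longrightarrow> j < b \<Longrightarrow> col A j \<in> poly_vec V a"
  by (auto simp: poly_mat_def poly_vec_def)

lemma poly_vec_unit: "unit_vec n j \<in> poly_vec V n"
  by (auto simp: poly_vec_def unit_vec_def poly_ring_zero poly_ring_one)

section \<open>Dimension of a quotient module\<close>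

text \<open>Every axiom for \<open>Q\<close> is checked on preimages under \<open>T\<close>, so
  \<open>Q\<close> need not be known to be a module beforehand. A quotient module, given only by raw
  operations on cosets, thus inherits its vector space structure from a coordinate space.\<close>

lemma vectorspace_transport:
  fixes W :: "('k::field, 'a, 'm) module_scheme" and Q :: "('k, 'b, 'n) module_scheme"
  assumes W: "vectorspace class_ring W"
    and bij: "bij_betw T (carrier W) (carrier Q)"
    and add: "\<And>u v. u \<in> carrier W \<Longrightarrow> v \<in> carrier W \<Longrightarrow> T u \<oplus>\<^bsub>Q\<^esub> T v = T (u \<oplus>\<^bsub>W\<^esub> v)"
    and smult: "\<And>a u. u \<in> carrier W \<Longrightarrow> a \<odot>\<^bsub>Q\<^esub> T u = T (a \<odot>\<^bsub>W\<^esub> u)"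
    and zero: "T \<zero>\<^bsub>W\<^esub> = \<zero>\<^bsub>Q\<^esub>"
  shows "linear_map class_ring W Q T"
proof -
  interpret W: vectorspace class_ring W by (rule W)
  have surj: "\<exists>u \<in> carrier W. x = T u" if "x \<in> carrier Q" for x
    using that bij by (auto simp: bij_betw_def)
  have T: "T u \<in> carrier Q" if "u \<in> carrier W" for u
    using that bij by (auto simp: bij_betw_def)
  have sm [simp]: "a \<odot>\<^bsub>W\<^esub> u \<in> carrier W" if "u \<in> carrier W" for a u
    using W.smult_closed[of a u] that by (simp add: class_ring_simps)
  have "abelian_group Q"
  proof (rule abelian_groupI)
    fix x y assume "x \<in> carrier Q" "y \<in> carrier Q"
    then obtain u v where u: "u \<in> carrier W" "x = T u" and v: "v \<in> carrier W" "y = T v"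
      using surj by metis
    then show "x \<oplus>\<^bsub>Q\<^esub> y \<in> carrier Q" by (simp add: add T)
    show "x \<oplus>\<^bsub>Q\<^esub> y = y \<oplus>\<^bsub>Q\<^esub> x" using u v by (simp add: add W.a_comm)
  next
    fix x y z assume "x \<in> carrier Q" "y \<in> carrier Q" "z \<in> carrier Q"
    then obtain u v w where "u \<in> carrier W" "x = T u" "v \<in> carrier W" "y = T v"
      "w \<in> carrier W" "z = T w"
      using surj by metis
    then show "x \<oplus>\<^bsub>Q\<^esub> y \<oplus>\<^bsub>Q\<^esub> z = x \<oplus>\<^bsub>Q\<^esub> (y \<oplus>\<^bsub>Q\<^esub> z)" by (simp add: add W.a_assoc)
  next
    show "\<zero>\<^bsub>Q\<^esub> \<in> carrier Q" using T[of "\<zero>\<^bsub>W\<^esub>"] zero by simp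
  next
    fix x assume "x \<in> carrier Q"
    then obtain u where u: "u \<in> carrier W" "x = T u" using surj by metis
    then show "\<zero>\<^bsub>Q\<^esub> \<oplus>\<^bsub>Q\<^esub> x = x" by (simp add: add flip: zero)
    from u have "T (\<ominus>\<^bsub>W\<^esub> u) \<oplus>\<^bsub>Q\<^esub> x = \<zero>\<^bsub>Q\<^esub>" by (simp add: add W.l_neg flip: zero)
    then show "\<exists>y \<in> carrier Q. y \<oplus>\<^bsub>Q\<^esub> x = \<zero>\<^bsub>Q\<^esub>" using u by (intro bexI[of _ "T (\<ominus>\<^bsub>W\<^esub> u)"] T) auto
  qed
  then have "Module.module class_ring Q"
  proof (intro moduleI)
    show "cring (class_ring :: 'k ring)" using W.module_axioms by (simp add: Module.module_def)
  next
    fix a :: 'k and x assume "x \<in> carrier Q"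
    then obtain u where u: "u \<in> carrier W" "x = T u" using surj by metis
    then show "a \<odot>\<^bsub>Q\<^esub> x \<in> carrier Q" by (simp add: smult T)
    show "\<one>\<^bsub>class_ring\<^esub> \<odot>\<^bsub>Q\<^esub> x = x"
      using u W.smult_one[of u] by (simp add: smult)
    fix b :: 'k
    show "(a \<oplus>\<^bsub>class_ring\<^esub> b) \<odot>\<^bsub>Q\<^esub> x = a \<odot>\<^bsub>Q\<^esub> x \<oplus>\<^bsub>Q\<^esub> b \<odot>\<^bsub>Q\<^esub> x"
      using u W.smult_l_distr[of a b u] by (simp add: smult add class_ring_simps)
    show "(a \<otimes>\<^bsub>class_ring\<^esub> b) \<odot>\<^bsub>Q\<^esub> x = a \<odot>\<^bsub>Q\<^esub> (b \<odot>\<^bsub>Q\<^esub> x)"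
      using u W.smult_assoc1[of a b u] by (simp add: smult class_ring_simps)
  next
    fix a :: 'k and x y assume "x \<in> carrier Q" "y \<in> carrier Q"
    then obtain u v where "u \<in> carrier W" "x = T u" "v \<in> carrier W" "y = T v"
      using surj by metis
    then show "a \<odot>\<^bsub>Q\<^esub> (x \<oplus>\<^bsub>Q\<^esub> y) = a \<odot>\<^bsub>Q\<^esub> x \<oplus>\<^bsub>Q\<^esub> a \<odot>\<^bsub>Q\<^esub> y"
      using W.smult_r_distr[of a u v] by (simp add: smult add class_ring_simps)
  qed
  then show ?thesis
    using W unfolding linear_map_def vectorspace_def mod_hom_def mod_hom_axioms_def module_hom_def
    by (auto simp: T add smult class_ring_simps)
qed

lemma zero_mult_mat_vec:
  fixes w :: "'a::semiring_0 vec"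
  shows "w \<in> carrier_vec b \<Longrightarrow> 0\<^sub>m a b *\<^sub>v w = 0\<^sub>v a"
  by (intro eq_vecI) (auto simp: scalar_prod_def)

lemma mult_mat_zero_vec:
  fixes A :: "'a::semiring_0 mat"
  shows "A \<in> carrier_mat a b \<Longrightarrow> A *\<^sub>v 0\<^sub>v b = 0\<^sub>v a"
  by (intro eq_vecI) (auto simp: scalar_prod_def)

text \<open>\<open>F\<close> and \<open>G\<close> induce mutually inverse maps between
  \<open>Z\<close> modulo \<open>N\<close> and the coordinate space of dimension \<open>m\<close>:
  \<open>FD\<close> makes \<open>F\<close> constant on cosets, \<open>FG\<close> gives one
  composite, and \<open>hom\<close> says that \<open>G\<close> after \<open>F\<close> moves
  \<open>z\<close> only by an element of \<open>N\<close>.\<close>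

lemma dim_quotient_module:
  fixes F G D H :: "'k::field mat" and p m n :: nat
  defines "N \<equiv> {D *\<^sub>v w | w. w \<in> carrier_vec p}"
  assumes D: "D \<in> carrier_mat n p" and F: "F \<in> carrier_mat m n"
    and G: "G \<in> carrier_mat n m" and H: "H \<in> carrier_mat p n"
    and FG: "F * G = 1\<^sub>m m" and FD: "F * D = 0\<^sub>m m p"
    and Z: "Z \<subseteq> carrier_vec n"
    and Zadd: "\<And>x y. x \<in> Z \<Longrightarrow> y \<in> Z \<Longrightarrow> x + y \<in> Z"
    and Zsmult: "\<And>a x. x \<in> Z \<Longrightarrow> a \<cdot>\<^sub>v x \<in> Z"
    and ZD: "\<And>w. w \<in> carrier_vec p \<Longrightarrow> D *\<^sub>v w \<in> Z"
    and ZG: "\<And>u. u \<in> carrier_vec m \<Longrightarrow> G *\<^sub>v u \<in> Z"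
    and hom: "\<And>z. z \<in> Z \<Longrightarrow> G *\<^sub>v (F *\<^sub>v z) = D *\<^sub>v (H *\<^sub>v z) + z"
  shows "vectorspace.dim class_ring
    (quotient_module (module_vec TYPE('k) n \<lparr> carrier := Z \<rparr>) N) = m"
proof -
  let ?M = "module_vec TYPE('k) n \<lparr> carrier := Z \<rparr>"
  let ?Q = "quotient_module ?M N"
  define c where "c x = N +>\<^bsub>?M\<^esub> x" for x
  have c: "c x = {D *\<^sub>v w + x | w. w \<in> carrier_vec p}" for x
    by (auto simp: c_def a_r_coset_def' N_def module_vec_def)
  have Fc: "F *\<^sub>v (D *\<^sub>v w + x) = F *\<^sub>v x" if "w \<in> carrier_vec p" "x \<in> carrier_vec n" for w x
  proof -
    have "F *\<^sub>v (D *\<^sub>v w) = (F * D) *\<^sub>v w"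
      using F D that by (simp add: assoc_mult_mat_vec)
    also have "\<dots> = 0\<^sub>v m" unfolding FD by (rule zero_mult_mat_vec[OF that(1)])
    finally show ?thesis
      using F D that by (subst mult_add_distrib_mat_vec[of _ m n]) auto
  qed
  have cancel: "x = a + x - a" if "a \<in> carrier_vec n" "x \<in> carrier_vec n" for a x :: "'k vec"
    using that by (intro eq_vecI) auto
  have rearrange: "a + (b + y - b') = a + b - b' + y"
    if "a \<in> carrier_vec n" "b \<in> carrier_vec n" "b' \<in> carrier_vec n" "y \<in> carrier_vec n"
    for a b b' y :: "'k vec"
    using that by (intro eq_vecI) auto
  have c_eqI: "c x = c y" if "x \<in> Z" "y \<in> Z" "F *\<^sub>v x = F *\<^sub>v y" for x y
  proof -
    have sub: "c x \<subseteq> c y" if "x \<in> Z" "y \<in> Z" "F *\<^sub>v x = F *\<^sub>v y" for x y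
    proof
      fix a assume "a \<in> c x"
      then obtain w where w: "w \<in> carrier_vec p" "a = D *\<^sub>v w + x" by (auto simp: c)
      have xy: "x \<in> carrier_vec n" "y \<in> carrier_vec n" using that Z by auto
      have Dw: "D *\<^sub>v u \<in> carrier_vec n" if "u \<in> carrier_vec p" for u
        using D that by (simp add: mult_mat_vec_carrier)
      have Hc: "H *\<^sub>v u \<in> carrier_vec p" if "u \<in> carrier_vec n" for u
        using H that by (simp add: mult_mat_vec_carrier)
      \<comment> \<open>By \<open>hom\<close> both sides equal \<open>G\<close> applied to the
        common image of \<open>x\<close> and \<open>y\<close> under \<open>F\<close>.\<close>
      have eq: "D *\<^sub>v (H *\<^sub>v x) + x = D *\<^sub>v (H *\<^sub>v y) + y"
        using hom that by metis
      have x: "x = D *\<^sub>v (H *\<^sub>v y) + y - D *\<^sub>v (H *\<^sub>v x)"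
        unfolding eq[symmetric] using cancel[OF Dw[OF Hc[OF xy(1)]] xy(1)] .
      have "D *\<^sub>v (w + H *\<^sub>v y - H *\<^sub>v x) = D *\<^sub>v w + D *\<^sub>v (H *\<^sub>v y) - D *\<^sub>v (H *\<^sub>v x)"
        using w(1) Hc xy D
        by (subst mult_minus_distrib_mat_vec[of _ n p]) (auto simp: mult_add_distrib_mat_vec[of _ n p])
      then have "a = D *\<^sub>v (w + H *\<^sub>v y - H *\<^sub>v x) + y"
        unfolding w(2) using rearrange[OF Dw[OF w(1)] Dw[OF Hc[OF xy(2)]] Dw[OF Hc[OF xy(1)]] xy(2)] x
        by simp
      moreover have "w + H *\<^sub>v y - H *\<^sub>v x \<in> carrier_vec p" using w(1) Hc xy by auto
      ultimately show "a \<in> c y" unfolding c by blast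
    qed
    show ?thesis using sub[of x y] sub[of y x] that by auto
  qed
  have D0: "D *\<^sub>v 0\<^sub>v p = 0\<^sub>v n"
    by (rule mult_mat_zero_vec[OF D])
  have G0: "G *\<^sub>v 0\<^sub>v m = 0\<^sub>v n"
    by (rule mult_mat_zero_vec[OF G])
  have c_self: "x \<in> c x" if "x \<in> Z" for x
  proof -
    have "x = D *\<^sub>v 0\<^sub>v p + x"
      unfolding D0 using left_zero_vec[of x n] that Z by (simp add: subset_iff)
    then show ?thesis
      unfolding c by (intro CollectI exI[of _ "0\<^sub>v p"] conjI zero_carrier_vec)
  qed
  have F_of_c: "F *\<^sub>v a = F *\<^sub>v x" if "a \<in> c x" "x \<in> Z" for a x
    using that Z Fc by (auto simp: c)
  have cZ: "c x \<subseteq> Z" if "x \<in> Z" for x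
    using that Zadd ZD by (auto simp: c)
  define T where "T u = c (G *\<^sub>v u)" for u
  have FGu: "F *\<^sub>v (G *\<^sub>v u) = u" if "u \<in> carrier_vec m" for u
    using that F G FG by (simp flip: assoc_mult_mat_vec)
  \<comment> \<open>Surjectivity of \<open>T\<close>: a vector of \<open>Z\<close> and its image
    under \<open>G\<close> after \<open>F\<close> agree under \<open>F\<close>, hence have the same
    coset.\<close>
  have cT: "c x = T (F *\<^sub>v x)" if "x \<in> Z" for x
    unfolding T_def using that F Z by (intro c_eqI ZG) (auto simp: FGu subset_iff)
  have carrier: "carrier ?Q = c ` Z"
    by (auto simp: quotient_module_def A_RCOSETS_def' c_def)
  have add: "c x \<oplus>\<^bsub>?Q\<^esub> c y = c (x + y)" if "x \<in> Z" "y \<in> Z" for x y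
  proof -
    have xy: "x \<in> carrier_vec n" "y \<in> carrier_vec n" using that Z by auto
    have "c x \<oplus>\<^bsub>?Q\<^esub> c y = {a + b | a b. a \<in> c x \<and> b \<in> c y}"
      by (auto simp: quotient_module_def set_add_def' module_vec_def)
    also have "\<dots> = c (x + y)"
    proof (intro equalityI subsetI)
      fix s assume "s \<in> {a + b | a b. a \<in> c x \<and> b \<in> c y}"
      then obtain v w where vw: "v \<in> carrier_vec p" "w \<in> carrier_vec p"
        "s = (D *\<^sub>v v + x) + (D *\<^sub>v w + y)" by (auto simp: c)
      have Dvw: "D *\<^sub>v v \<in> carrier_vec n" "D *\<^sub>v w \<in> carrier_vec n"
        using D vw(1,2) by (auto intro: mult_mat_vec_carrier)
      have "s = D *\<^sub>v (v + w) + (x + y)"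
        unfolding vw(3) mult_add_distrib_mat_vec[OF D vw(1,2)]
        using Dvw xy by (intro eq_vecI) auto
      then show "s \<in> c (x + y)"
        unfolding c using vw(1,2) by (intro CollectI exI[of _ "v + w"]) auto
    next
      fix s assume "s \<in> c (x + y)"
      then obtain v where v: "v \<in> carrier_vec p" "s = D *\<^sub>v v + (x + y)" by (auto simp: c)
      have "D *\<^sub>v v \<in> carrier_vec n"
        using D v(1) by (rule mult_mat_vec_carrier)
      then have "s = (D *\<^sub>v v + x) + y"
        unfolding v(2) using xy by (intro eq_vecI) auto
      moreover have "D *\<^sub>v v + x \<in> c x"
        unfolding c using v(1) by (intro CollectI exI[of _ v]) simp
      ultimately show "s \<in> {a + b | a b. a \<in> c x \<and> b \<in> c y}"
        using c_self[OF that(2)] by (intro CollectI exI[of _ "D *\<^sub>v v + x"] exI[of _ y]) simp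
    qed
    finally show ?thesis .
  qed
  have smult: "a \<odot>\<^bsub>?Q\<^esub> c x = c (a \<cdot>\<^sub>v x)" if "x \<in> Z" for a x
  proof -
    have "a \<odot>\<^bsub>?Q\<^esub> c x = (\<Union>y \<in> c x. c (a \<cdot>\<^sub>v y))"
      by (auto simp: quotient_module_def c_def module_vec_def)
    \<comment> \<open>A scalar multiple of a coset is a union over the members of the coset;
      \<open>F\<close> agrees on all their multiples, so the cosets united here coincide.\<close>
    also have "\<dots> = (\<Union>y \<in> c x. c (a \<cdot>\<^sub>v x))"
    proof (intro SUP_cong refl c_eqI)
      fix y assume y: "y \<in> c x"
      then show "a \<cdot>\<^sub>v y \<in> Z" "a \<cdot>\<^sub>v x \<in> Z" using cZ that Zsmult by auto
      have "y \<in> carrier_vec n" "x \<in> carrier_vec n" using y cZ that Z by auto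
      then show "F *\<^sub>v (a \<cdot>\<^sub>v y) = F *\<^sub>v (a \<cdot>\<^sub>v x)"
        using F_of_c[OF y that] F by (simp add: mult_mat_vec[of _ m n])
    qed
    also have "\<dots> = c (a \<cdot>\<^sub>v x)" using c_self[OF that] by auto
    finally show ?thesis .
  qed
  have zero: "c (0\<^sub>v n) = \<zero>\<^bsub>?Q\<^esub>"
  proof -
    have "D *\<^sub>v w + 0\<^sub>v n = D *\<^sub>v w" if "w \<in> carrier_vec p" for w
      by (rule right_zero_vec[OF mult_mat_vec_carrier[OF D that]])
    then have "c (0\<^sub>v n) = N"
      unfolding c N_def by metis
    then show ?thesis
      by (simp add: quotient_module_def)
  qed
  have bij: "bij_betw T (carrier (module_vec TYPE('k) m)) (carrier ?Q)"
    unfolding bij_betw_def carrier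
  proof
    show "inj_on T (carrier (module_vec TYPE('k) m))"
    proof (rule inj_onI)
      fix u v assume uv: "u \<in> carrier (module_vec TYPE('k) m)"
        "v \<in> carrier (module_vec TYPE('k) m)" "T u = T v"
      then have u: "u \<in> carrier_vec m" and v: "v \<in> carrier_vec m"
        by (simp_all add: module_vec_simps)
      have "G *\<^sub>v u \<in> c (G *\<^sub>v v)" using uv(3) c_self ZG[OF u] by (metis T_def)
      then show "u = v" using F_of_c ZG[OF v] FGu u v by metis
    qed
    show "T ` carrier (module_vec TYPE('k) m) = c ` Z"
      using cT ZG F Z by (auto simp: T_def module_vec_simps image_iff subset_iff)
  qed
  have lin: "linear_map class_ring (module_vec TYPE('k) m) ?Q T"
  proof (rule vectorspace_transport[OF vec_vs bij])
    show "T \<zero>\<^bsub>module_vec TYPE('k) m\<^esub> = \<zero>\<^bsub>?Q\<^esub>"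
      using zero G0 by (simp add: T_def module_vec_simps)
  qed (use G ZG in \<open>auto simp: T_def add smult module_vec_simps mult_add_distrib_mat_vec[of _ n m] mult_mat_vec[of _ n m]\<close>)
  have "vectorspace.dim class_ring (module_vec TYPE('k) m) = vectorspace.dim class_ring ?Q"
    using bij by (intro linear_map.dim_eq[OF lin vec_space.fin_dim]) (simp_all add: bij_betw_def)
  then show ?thesis by (simp add: vec_space.dim_is_n)
qed

section \<open>Comparison of free resolutions\<close>

lemma free_resolutionD:
  assumes "free_resolution V I d"
  shows "d 0 \<in> poly_mat V 1 (dim_col (d 0))"
    and "d (Suc n) \<in> poly_mat V (dim_col (d n)) (dim_col (d (Suc n)))"
    and "{(d 0 *\<^sub>v v) $ 0 | v. v \<in> poly_vec V (dim_col (d 0))} = I"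
    and "{v \<in> poly_vec V (dim_col (d n)). d n *\<^sub>v v = 0\<^sub>v (dim_row (d n))} =
      {d (Suc n) *\<^sub>v w | w. w \<in> poly_vec V (dim_col (d (Suc n)))}"
  using assms unfolding free_resolution_def by blast+

lemma free_resolution_dim_row [simp]:
  "free_resolution V I d \<Longrightarrow> dim_row (d (Suc n)) = dim_col (d n)"
  "free_resolution V I d \<Longrightarrow> dim_row (d 0) = 1"
  by (rule carrier_matD(1)[OF poly_mat_carrier[OF free_resolutionD(2)]]
      carrier_matD(1)[OF poly_mat_carrier[OF free_resolutionD(1)]], assumption)+

lemma free_resolution_poly_mat:
  assumes d: "free_resolution V I d"
  shows "d n \<in> poly_mat V (dim_row (d n)) (dim_col (d n))"
proof (cases n)
  case 0
  show ?thesis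
    unfolding 0 free_resolution_dim_row(2)[OF d] by (rule free_resolutionD(1)[OF d])
next
  case (Suc m)
  show ?thesis
    unfolding Suc free_resolution_dim_row(1)[OF d] by (rule free_resolutionD(2)[OF d])
qed

lemma free_resolution_carrier_Suc:
  "free_resolution V I d \<Longrightarrow> d (Suc n) \<in> carrier_mat (dim_col (d n)) (dim_col (d (Suc n)))"
  by (rule poly_mat_carrier[OF free_resolutionD(2)])

lemma poly_mat_of_columns:
  assumes "\<And>j. j < c \<Longrightarrow> w j \<in> poly_vec V b"
  shows "mat_of_cols b (map w [0..<c]) \<in> poly_mat V b c"
    and "j < c \<Longrightarrow> col (mat_of_cols b (map w [0..<c])) j = w j"
proof -
  have w: "w j \<in> carrier_vec b" if "j < c" for j
    using assms[OF that] by (simp add: poly_vec_def)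
  then show "mat_of_cols b (map w [0..<c]) \<in> poly_mat V b c"
    using assms by (auto simp: poly_mat_def poly_vec_def mat_of_cols_index)
  show "col (mat_of_cols b (map w [0..<c])) j = w j" if "j < c"
    using w[OF that] that by (subst col_mat_of_cols) auto
qed

lemma mult_mat_of_columns:
  assumes "A \<in> carrier_mat a b" "B \<in> carrier_mat a c"
    and "\<And>j. j < c \<Longrightarrow> w j \<in> poly_vec V b" "\<And>j. j < c \<Longrightarrow> A *\<^sub>v w j = col B j"
  shows "A * mat_of_cols b (map w [0..<c]) = B"
proof (rule mat_col_eqI)
  let ?W = "mat_of_cols b (map w [0..<c])"
  have W: "?W \<in> carrier_mat b c"
    using poly_mat_of_columns(1)[of c w V b] assms(3) poly_mat_carrier by blast
  fix j assume "j < dim_col B"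
  then have j: "j < c" using assms(2) by simp
  then show "col (A * ?W) j = col B j"
    using poly_mat_of_columns(2)[of c w V b j] assms W by (subst col_mult2[of _ a b _ c]) auto
qed (use assms in auto)

text \<open>Free modules are projective: each column of \<open>A\<close> is a cycle, exactness
  provides a preimage, and the chosen preimages are the columns of \<open>B\<close>.\<close>

lemma free_resolution_lift:
  assumes d: "free_resolution V I d"
    and A: "A \<in> poly_mat V (dim_col (d n)) c"
    and 0: "d n * A = 0\<^sub>m (dim_row (d n)) c"
  shows "\<exists>B \<in> poly_mat V (dim_col (d (Suc n))) c. d (Suc n) * B = A"
proof -
  note dn = poly_mat_carrier[OF free_resolution_poly_mat[OF d]]
  have "\<exists>w. w \<in> poly_vec V (dim_col (d (Suc n))) \<and> d (Suc n) *\<^sub>v w = col A j" if j: "j < c" for j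
  proof -
    have "d n *\<^sub>v col A j = col (d n * A) j"
      using dn poly_mat_carrier[OF A] j by (subst col_mult2) auto
    also have "\<dots> = 0\<^sub>v (dim_row (d n))"
      unfolding 0 using j by (intro eq_vecI) auto
    finally have "col A j \<in> {v \<in> poly_vec V (dim_col (d n)). d n *\<^sub>v v = 0\<^sub>v (dim_row (d n))}"
      using poly_mat_col[OF A j] by simp
    then show ?thesis
      unfolding free_resolutionD(4)[OF d] by auto
  qed
  then obtain w where w: "\<And>j. j < c \<Longrightarrow> w j \<in> poly_vec V (dim_col (d (Suc n)))"
    "\<And>j. j < c \<Longrightarrow> d (Suc n) *\<^sub>v w j = col A j"
    by metis
  have "d (Suc n) * mat_of_cols (dim_col (d (Suc n))) (map w [0..<c]) = A"
    by (rule mult_mat_of_columns[OF free_resolution_carrier_Suc[OF d] poly_mat_carrier[OF A] w])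
  then show ?thesis
    using poly_mat_of_columns(1)[of c w] w(1) by blast
qed

lemma free_resolution_lift_augmentation:
  assumes d: "free_resolution V I d"
    and A: "A \<in> poly_mat V 1 c" "\<And>j. j < c \<Longrightarrow> A $$ (0, j) \<in> I"
  shows "\<exists>B \<in> poly_mat V (dim_col (d 0)) c. d 0 * B = A"
proof -
  note d0 = poly_mat_carrier[OF free_resolutionD(1)[OF d]] and Ac = poly_mat_carrier[OF A(1)]
  have "\<exists>w. w \<in> poly_vec V (dim_col (d 0)) \<and> (d 0 *\<^sub>v w) $ 0 = A $$ (0, j)" if j: "j < c" for j
    using A(2)[OF j] unfolding free_resolutionD(3)[OF d, symmetric] by auto
  then obtain w where w: "\<And>j. j < c \<Longrightarrow> w j \<in> poly_vec V (dim_col (d 0))"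
    "\<And>j. j < c \<Longrightarrow> (d 0 *\<^sub>v w j) $ 0 = A $$ (0, j)"
    by metis
  have "d 0 * mat_of_cols (dim_col (d 0)) (map w [0..<c]) = A"
  proof (rule mult_mat_of_columns[OF d0 Ac w(1)])
    fix j assume j: "j < c"
    show "d 0 *\<^sub>v w j = col A j"
    proof (rule eq_vecI)
      fix i assume "i < dim_vec (col A j)"
      then have "i = 0" using Ac by simp
      then show "(d 0 *\<^sub>v w j) $ i = col A j $ i"
        using w(2)[OF j] Ac j by (simp only: index_col carrier_matD)
    qed (simp only: dim_mult_mat_vec dim_col carrier_matD[OF d0] carrier_matD[OF Ac])
  qed
  then show ?thesis
    using poly_mat_of_columns(1)[of c w] w(1) by blast
qed

lemma mult_mat_unit_vec:
  fixes A :: "'a::semiring_1 mat"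
  assumes "A \<in> carrier_mat a b" "j < b"
  shows "A *\<^sub>v unit_vec b j = col A j"
  using assms by (intro eq_vecI) (auto simp: scalar_prod_right_unit)

lemma free_resolution_complex:
  assumes d: "free_resolution V I d"
  shows "d n * d (Suc n) = 0\<^sub>m (dim_row (d n)) (dim_col (d (Suc n)))"
proof (rule mat_col_eqI)
  note dn = poly_mat_carrier[OF free_resolution_poly_mat[OF d]]
  fix j assume "j < dim_col (0\<^sub>m (dim_row (d n)) (dim_col (d (Suc n))))"
  then have j: "j < dim_col (d (Suc n))" by simp
  have "col (d (Suc n)) j = d (Suc n) *\<^sub>v unit_vec (dim_col (d (Suc n))) j"
    using mult_mat_unit_vec[OF dn j] by simp
  then have "col (d (Suc n)) j \<in> {v \<in> poly_vec V (dim_col (d n)). d n *\<^sub>v v = 0\<^sub>v (dim_row (d n))}"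
    unfolding free_resolutionD(4)[OF d] using poly_vec_unit by blast
  then have "d n *\<^sub>v col (d (Suc n)) j = 0\<^sub>v (dim_row (d n))" by simp
  moreover have "col (d n * d (Suc n)) j = d n *\<^sub>v col (d (Suc n)) j"
    by (rule col_mult2[OF carrier_mat_triv free_resolution_carrier_Suc[OF d] j])
  ultimately show "col (d n * d (Suc n)) j = col (0\<^sub>m (dim_row (d n)) (dim_col (d (Suc n)))) j"
    using j by (auto intro!: eq_vecI)
qed (use d in auto)

lemma free_resolution_augmentation_entry:
  assumes d: "free_resolution V I d" and j: "j < dim_col (d 0)"
  shows "d 0 $$ (0, j) \<in> I"
proof -
  note d0 = poly_mat_carrier[OF free_resolutionD(1)[OF d]]
  have "(d 0 *\<^sub>v unit_vec (dim_col (d 0)) j) $ 0 = d 0 $$ (0, j)"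
    unfolding mult_mat_unit_vec[OF d0 j]
    by (rule index_col[OF _ j]) (simp only: carrier_matD(1)[OF d0] zero_less_one)
  then show ?thesis
    unfolding free_resolutionD(3)[OF d, symmetric]
    by (intro CollectI exI[of _ "unit_vec (dim_col (d 0)) j"]) (simp add: poly_vec_unit)
qed

lemma comparison_map:
  assumes d: "free_resolution V I d" and e: "free_resolution V I e"
  shows "\<exists>f. (\<forall>n. f n \<in> poly_mat V (dim_col (e n)) (dim_col (d n))) \<and> e 0 * f 0 = d 0 \<and>
    (\<forall>n. e (Suc n) * f (Suc n) = f n * d (Suc n))"
proof -
  note ec = poly_mat_carrier[OF free_resolution_poly_mat[OF e]]
  \<comment> \<open>The second conjunct says that \<open>x * d (Suc n)\<close> lands in the cycles
    of \<open>e\<close>, which is what lifting to the next degree requires. The commuting square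
    relates two consecutive choices and is therefore part of the step relation, not of
    \<open>P\<close>.\<close>
  define P where "P n x \<longleftrightarrow> x \<in> poly_mat V (dim_col (e n)) (dim_col (d n)) \<and>
    e n * x * d (Suc n) = 0\<^sub>m (dim_row (e n)) (dim_col (d (Suc n))) \<and> (n = 0 \<longrightarrow> e 0 * x = d 0)" for n x
  have "\<exists>f. \<forall>n. P n (f n) \<and> e (Suc n) * f (Suc n) = f n * d (Suc n)"
  proof (rule dependent_nat_choice)
    obtain x where x: "x \<in> poly_mat V (dim_col (e 0)) (dim_col (d 0))" "e 0 * x = d 0"
      using free_resolution_lift_augmentation[OF e free_resolutionD(1)[OF d]]
        free_resolution_augmentation_entry[OF d] by blast
    then show "\<exists>x. P 0 x"
      using free_resolution_complex[OF d, of 0] d e by (auto simp: P_def)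
  next
    fix x n assume x: "P n x"
    then have xc: "x \<in> carrier_mat (dim_col (e n)) (dim_col (d n))"
      unfolding P_def by (blast intro: poly_mat_carrier)
    note dS = free_resolution_carrier_Suc[OF d, of n]
      and dSS = free_resolution_carrier_Suc[OF d, of "Suc n"]
    have "x * d (Suc n) \<in> poly_mat V (dim_col (e n)) (dim_col (d (Suc n)))"
      using x unfolding P_def by (blast intro: poly_mat_mult free_resolutionD(2)[OF d])
    moreover have "e n * (x * d (Suc n)) = 0\<^sub>m (dim_row (e n)) (dim_col (d (Suc n)))"
      using x assoc_mult_mat[OF ec xc dS] by (simp add: P_def)
    ultimately obtain y where y: "y \<in> poly_mat V (dim_col (e (Suc n))) (dim_col (d (Suc n)))"
      "e (Suc n) * y = x * d (Suc n)"
      using free_resolution_lift[OF e] by blast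
    have "e (Suc n) * y * d (Suc (Suc n)) = 0\<^sub>m (dim_row (e (Suc n))) (dim_col (d (Suc (Suc n))))"
      unfolding y(2)
      by (simp add: assoc_mult_mat[OF xc dS dSS] free_resolution_complex[OF d]
        free_resolution_dim_row[OF d] free_resolution_dim_row[OF e] right_mult_zero_mat[OF xc])
    with y show "\<exists>y. P (Suc n) y \<and> e (Suc n) * y = x * d (Suc n)"
      by (auto simp: P_def)
  qed
  then show ?thesis by (auto simp: P_def)
qed

text \<open>\<open>\<phi>\<close> is a chain endomorphism over the zero map of \<open>I\<close>. In
  each degree, \<open>\<phi>\<close> minus the contribution of the homotopy already built is a
  cycle, hence lifts one degree up. Degree 0 is separate because no homotopy precedes it.\<close>

lemma null_homotopy:
  fixes d \<phi> :: "nat \<Rightarrow> ('v, 'k::field) mpoly mat"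
  assumes d: "free_resolution V I d"
    and \<phi>: "\<And>n. \<phi> n \<in> poly_mat V (dim_col (d n)) (dim_col (d n))"
    and \<phi>0: "d 0 * \<phi> 0 = 0\<^sub>m 1 (dim_col (d 0))"
    and \<phi>S: "\<And>n. d (Suc n) * \<phi> (Suc n) = \<phi> n * d (Suc n)"
  shows "\<exists>h. (\<forall>n. h n \<in> poly_mat V (dim_col (d (Suc n))) (dim_col (d n))) \<and>
    d (Suc 0) * h 0 = \<phi> 0 \<and>
    (\<forall>n. d (Suc (Suc n)) * h (Suc n) = \<phi> (Suc n) - h n * d (Suc n))"
proof -
  note \<phi>c = poly_mat_carrier[OF \<phi>]
  define P where "P n x \<longleftrightarrow> x \<in> poly_mat V (dim_col (d (Suc n))) (dim_col (d n)) \<and>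
    d (Suc n) * (\<phi> (Suc n) - x * d (Suc n)) = 0\<^sub>m (dim_col (d n)) (dim_col (d (Suc n))) \<and>
    (n = 0 \<longrightarrow> d (Suc 0) * x = \<phi> 0)" for n x
  note dS = free_resolution_carrier_Suc[OF d]
  \<comment> \<open>The right side vanishes for the chosen \<open>x\<close>: either
    \<open>d (Suc n) * x\<close> equals \<open>\<phi> n\<close>, or the difference is the preceding
    homotopy term, and then two consecutive differentials meet.\<close>
  have step: "d (Suc n) * (\<phi> (Suc n) - x * d (Suc n)) = (\<phi> n - d (Suc n) * x) * d (Suc n)"
    if "x \<in> carrier_mat (dim_col (d (Suc n))) (dim_col (d n))" for n x
  proof -
    have "d (Suc n) * (\<phi> (Suc n) - x * d (Suc n)) = d (Suc n) * \<phi> (Suc n) - d (Suc n) * (x * d (Suc n))"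
      by (rule mult_minus_distrib_mat[OF dS \<phi>c mult_carrier_mat[OF that dS]])
    also have "\<dots> = \<phi> n * d (Suc n) - d (Suc n) * x * d (Suc n)"
      using assoc_mult_mat[OF dS that dS] \<phi>S by simp
    also have "\<dots> = (\<phi> n - d (Suc n) * x) * d (Suc n)"
      by (simp only: minus_mult_distrib_mat[OF \<phi>c mult_carrier_mat[OF dS that] dS])
    finally show ?thesis .
  qed
  have cancel: "A - (A - B) = B" if "A \<in> carrier_mat a b" "B \<in> carrier_mat a b"
    for A B :: "('v, 'k) mpoly mat" and a b
    using that by (intro eq_matI) auto
  have "\<exists>h. \<forall>n. P n (h n) \<and> d (Suc (Suc n)) * h (Suc n) = \<phi> (Suc n) - h n * d (Suc n)"
  proof (rule dependent_nat_choice)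
    have "d 0 * \<phi> 0 = 0\<^sub>m (dim_row (d 0)) (dim_col (d 0))"
      using \<phi>0 d by simp
    then obtain x where x: "x \<in> poly_mat V (dim_col (d (Suc 0))) (dim_col (d 0))"
      "d (Suc 0) * x = \<phi> 0"
      using free_resolution_lift[OF d \<phi>] by blast
    then show "\<exists>x. P 0 x"
      by (intro exI[of _ x])
        (simp add: P_def step[OF poly_mat_carrier] minus_r_inv_mat[OF \<phi>c] left_mult_zero_mat[OF dS])
  next
    fix x n assume x: "P n x"
    then have xp: "x \<in> poly_mat V (dim_col (d (Suc n))) (dim_col (d n))" by (simp add: P_def)
    note xc = poly_mat_carrier[OF xp]
    have "\<phi> (Suc n) - x * d (Suc n) \<in> poly_mat V (dim_col (d (Suc n))) (dim_col (d (Suc n)))"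
      by (intro poly_mat_minus \<phi> poly_mat_mult[OF xp] free_resolutionD(2)[OF d])
    moreover have "d (Suc n) * (\<phi> (Suc n) - x * d (Suc n)) = 0\<^sub>m (dim_row (d (Suc n))) (dim_col (d (Suc n)))"
      using x by (simp add: P_def free_resolution_dim_row[OF d])
    ultimately obtain y where y: "y \<in> poly_mat V (dim_col (d (Suc (Suc n)))) (dim_col (d (Suc n)))"
      "d (Suc (Suc n)) * y = \<phi> (Suc n) - x * d (Suc n)"
      using free_resolution_lift[OF d] by blast
    note yc = poly_mat_carrier[OF y(1)]
    have "\<phi> (Suc n) - (\<phi> (Suc n) - x * d (Suc n)) = x * d (Suc n)"
      by (rule cancel[OF \<phi>c mult_carrier_mat[OF xc dS]])
    then have "d (Suc (Suc n)) * (\<phi> (Suc (Suc n)) - y * d (Suc (Suc n))) = x * d (Suc n) * d (Suc (Suc n))"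
      by (simp only: step[OF yc] y(2))
    also have "\<dots> = 0\<^sub>m (dim_col (d (Suc n))) (dim_col (d (Suc (Suc n))))"
      by (simp add: assoc_mult_mat[OF xc dS dS] free_resolution_complex[OF d]
        free_resolution_dim_row[OF d] right_mult_zero_mat[OF xc])
    finally show "\<exists>y. P (Suc n) y \<and> d (Suc (Suc n)) * y = \<phi> (Suc n) - x * d (Suc n)"
      using y by (auto simp: P_def)
  qed
  then obtain h where h: "\<And>n. P n (h n)"
    "\<And>n. d (Suc (Suc n)) * h (Suc n) = \<phi> (Suc n) - h n * d (Suc n)"
    by blast
  have "h n \<in> poly_mat V (dim_col (d (Suc n))) (dim_col (d n))" for n
    using h(1)[of n] unfolding P_def by blast
  moreover have "d (Suc 0) * h 0 = \<phi> 0"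
    using h(1)[of 0] unfolding P_def by blast
  ultimately show ?thesis
    using h(2) by blast
qed

text \<open>The difference of \<open>g n * f n\<close> and the identity lies over the zero map, as
  both \<open>f\<close> and \<open>g\<close> lie over the identity of \<open>I\<close>. Exchanging
  the roles of \<open>d\<close> and \<open>e\<close> gives the homotopy on the other
  resolution.\<close>

lemma comparison_homotopy:
  assumes d: "free_resolution V I d"
    and e: "free_resolution V I e"
    and f: "\<And>n. f n \<in> poly_mat V (dim_col (e n)) (dim_col (d n))"
      "e 0 * f 0 = d 0" "\<And>n. e (Suc n) * f (Suc n) = f n * d (Suc n)"
    and g: "\<And>n. g n \<in> poly_mat V (dim_col (d n)) (dim_col (e n))"
      "d 0 * g 0 = e 0" "\<And>n. d (Suc n) * g (Suc n) = g n * e (Suc n)"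
  shows "\<exists>h. (\<forall>n. h n \<in> poly_mat V (dim_col (d (Suc n))) (dim_col (d n))) \<and>
    d (Suc 0) * h 0 = g 0 * f 0 - 1\<^sub>m (dim_col (d 0)) \<and>
    (\<forall>n. d (Suc (Suc n)) * h (Suc n) =
      g (Suc n) * f (Suc n) - 1\<^sub>m (dim_col (d (Suc n))) - h n * d (Suc n))"
proof (rule null_homotopy[OF d])
  note dS = free_resolution_carrier_Suc[OF d] and eS = free_resolution_carrier_Suc[OF e]
    and d0 = poly_mat_carrier[OF free_resolutionD(1)[OF d]]
  note fc = poly_mat_carrier[OF f(1)] and gc = poly_mat_carrier[OF g(1)]
  fix n
  show "g n * f n - 1\<^sub>m (dim_col (d n)) \<in> poly_mat V (dim_col (d n)) (dim_col (d n))"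
    by (intro poly_mat_minus poly_mat_mult[OF g(1) f(1)] poly_mat_one)
  have gf: "g n * f n \<in> carrier_mat (dim_col (d n)) (dim_col (d n))" for n
    by (rule mult_carrier_mat[OF gc fc])
  have "d 0 * (g 0 * f 0 - 1\<^sub>m (dim_col (d 0))) = d 0 * (g 0 * f 0) - d 0 * 1\<^sub>m (dim_col (d 0))"
    by (rule mult_minus_distrib_mat[OF d0 gf one_carrier_mat])
  also have "\<dots> = d 0 - d 0"
    using assoc_mult_mat[OF d0 gc fc] f(2) g(2) by (simp add: right_mult_one_mat[OF d0])
  finally show "d 0 * (g 0 * f 0 - 1\<^sub>m (dim_col (d 0))) = 0\<^sub>m 1 (dim_col (d 0))"
    by (simp only: minus_r_inv_mat[OF d0])
  have "d (Suc n) * (g (Suc n) * f (Suc n) - 1\<^sub>m (dim_col (d (Suc n)))) =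
      d (Suc n) * (g (Suc n) * f (Suc n)) - d (Suc n) * 1\<^sub>m (dim_col (d (Suc n)))"
    by (rule mult_minus_distrib_mat[OF dS gf one_carrier_mat])
  also have "d (Suc n) * (g (Suc n) * f (Suc n)) = g n * e (Suc n) * f (Suc n)"
    using assoc_mult_mat[OF dS gc fc] g(3) by simp
  also have "\<dots> = g n * f n * d (Suc n)"
    using assoc_mult_mat[OF gc eS fc] assoc_mult_mat[OF gc fc dS] f(3) by simp
  also have "g n * f n * d (Suc n) - d (Suc n) * 1\<^sub>m (dim_col (d (Suc n))) =
      (g n * f n - 1\<^sub>m (dim_col (d n))) * d (Suc n)"
    using minus_mult_distrib_mat[OF gf one_carrier_mat dS]
    by (simp add: right_mult_one_mat[OF dS] left_mult_one_mat[OF dS])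
  finally show "d (Suc n) * (g (Suc n) * f (Suc n) - 1\<^sub>m (dim_col (d (Suc n)))) =
      (g n * f n - 1\<^sub>m (dim_col (d n))) * d (Suc n)" .
qed

lemma add_uminus_diff_vec:
  fixes z :: "'a::ab_group_add vec"
  assumes "z \<in> carrier_vec n" "y \<in> carrier_vec n" "y = g - z"  "g \<in> carrier_vec n"
  shows "g = y + z"
  using assms by (intro eq_vecI) auto

text \<open>After reduction the differentials of \<open>e\<close> are zero, so its homology in
  degree \<open>i\<close> is the whole space of dimension \<open>dim_col (e i)\<close>. The reduced
  comparison maps identify it with the homology of \<open>d\<close>; their properties are the
  hypotheses of \<open>dim_quotient_module\<close>.\<close>

theorem dim_tor_eq_rank:
  fixes d e :: "nat \<Rightarrow> ('v, 'k::field) mpoly mat"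
  assumes d: "free_resolution V I d" and e: "free_resolution V I e"
    and minimal: "\<And>n. residue_mat (e (Suc n)) = 0\<^sub>m (dim_col (e n)) (dim_col (e (Suc n)))"
  shows "vectorspace.dim class_ring (tor d i) = dim_col (e i)"
proof -
  obtain f where f: "\<And>n. f n \<in> poly_mat V (dim_col (e n)) (dim_col (d n))"
    "e 0 * f 0 = d 0" "\<And>n. e (Suc n) * f (Suc n) = f n * d (Suc n)"
    using comparison_map[OF d e] by blast
  obtain g where g: "\<And>n. g n \<in> poly_mat V (dim_col (d n)) (dim_col (e n))"
    "d 0 * g 0 = e 0" "\<And>n. d (Suc n) * g (Suc n) = g n * e (Suc n)"
    using comparison_map[OF e d] by blast
  obtain h where h: "\<And>n. h n \<in> poly_mat V (dim_col (d (Suc n))) (dim_col (d n))"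
    "d (Suc 0) * h 0 = g 0 * f 0 - 1\<^sub>m (dim_col (d 0))"
    "\<And>n. d (Suc (Suc n)) * h (Suc n) = g (Suc n) * f (Suc n) - 1\<^sub>m (dim_col (d (Suc n))) - h n * d (Suc n)"
    using comparison_homotopy[OF d e f g] by blast
  obtain k where k: "\<And>n. k n \<in> poly_mat V (dim_col (e (Suc n))) (dim_col (e n))"
    "e (Suc 0) * k 0 = f 0 * g 0 - 1\<^sub>m (dim_col (e 0))"
    "\<And>n. e (Suc (Suc n)) * k (Suc n) = f (Suc n) * g (Suc n) - 1\<^sub>m (dim_col (e (Suc n))) - k n * e (Suc n)"
    using comparison_homotopy[OF e d g f] by blast
  note dS = free_resolution_carrier_Suc[OF d] and eS = free_resolution_carrier_Suc[OF e]
  note fc = poly_mat_carrier[OF f(1)] and gc = poly_mat_carrier[OF g(1)]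
    and hc = poly_mat_carrier[OF h(1)] and kc = poly_mat_carrier[OF k(1)]
  define D where "D n = residue_mat (d n)" for n
  define F where "F n = residue_mat (f n)" for n
  define G where "G n = residue_mat (g n)" for n
  define H where "H n = residue_mat (h n)" for n
  define K where "K n = residue_mat (k n)" for n
  have D: "D (Suc n) \<in> carrier_mat (dim_col (d n)) (dim_col (d (Suc n)))" for n
    unfolding D_def by (rule residue_mat_carrier[OF dS])
  have F: "F n \<in> carrier_mat (dim_col (e n)) (dim_col (d n))" for n
    unfolding F_def by (rule residue_mat_carrier[OF fc])
  have G: "G n \<in> carrier_mat (dim_col (d n)) (dim_col (e n))" for n
    unfolding G_def by (rule residue_mat_carrier[OF gc])
  have H: "H n \<in> carrier_mat (dim_col (d (Suc n))) (dim_col (d n))" for n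
    unfolding H_def by (rule residue_mat_carrier[OF hc])
  have K: "K n \<in> carrier_mat (dim_col (e (Suc n))) (dim_col (e n))" for n
    unfolding K_def by (rule residue_mat_carrier[OF kc])
  have FD: "F n * D (Suc n) = 0\<^sub>m (dim_col (e n)) (dim_col (d (Suc n)))" for n
    using arg_cong[OF f(3)[of n], of residue_mat] F[of "Suc n"]
    by (simp add: residue_mat_mult[OF eS fc] residue_mat_mult[OF fc dS] minimal
        F_def[symmetric] D_def[symmetric])
  have DG: "D (Suc n) * G (Suc n) = 0\<^sub>m (dim_col (d n)) (dim_col (e (Suc n)))" for n
    using arg_cong[OF g(3)[of n], of residue_mat] G[of n]
    by (simp add: residue_mat_mult[OF dS gc] residue_mat_mult[OF gc eS] minimal
        G_def[symmetric] D_def[symmetric])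
  have DD: "D (Suc n) * D (Suc (Suc n)) = 0\<^sub>m (dim_col (d n)) (dim_col (d (Suc (Suc n))))" for n
    using arg_cong[OF free_resolution_complex[OF d, of "Suc n"], of residue_mat] d
    by (simp add: residue_mat_mult[OF dS dS] residue_mat_zero D_def[symmetric])
  have eq_one: "A = 1\<^sub>m m" if "0\<^sub>m m m = A - 1\<^sub>m m" "A \<in> carrier_mat m m" for A :: "'k mat" and m
  proof (rule eq_matI)
    fix i j assume ij: "i < dim_row (1\<^sub>m m :: 'k mat)" "j < dim_col (1\<^sub>m m :: 'k mat)"
    have "(A - 1\<^sub>m m) $$ (i, j) = 0" unfolding that(1)[symmetric] using ij by simp
    then show "A $$ (i, j) = 1\<^sub>m m $$ (i, j)" using ij by simp
  qed (use that in auto)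
  have FGc: "f n * g n \<in> carrier_mat (dim_col (e n)) (dim_col (e n))"
    and GFc: "g n * f n \<in> carrier_mat (dim_col (d n)) (dim_col (d n))" for n
    using fc[of n] gc[of n] by simp_all
  \<comment> \<open>The homotopy on \<open>e\<close> enters only through products with positive
    differentials of \<open>e\<close>, whose reductions are zero. The composite is thus the identity
    itself, not merely homotopic to it.\<close>
  have FG: "F n * G n = 1\<^sub>m (dim_col (e n))" for n
  proof (rule eq_one)
    show "0\<^sub>m (dim_col (e n)) (dim_col (e n)) = F n * G n - 1\<^sub>m (dim_col (e n))"
    proof (cases n)
      case 0
      show ?thesis
        using arg_cong[OF k(2), of residue_mat] K[of 0] unfolding 0
        by (simp add: residue_mat_mult[OF eS kc] residue_mat_minus[OF FGc one_carrier_mat]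
          residue_mat_mult[OF fc gc] residue_mat_one minimal K_def[symmetric]
          F_def[symmetric] G_def[symmetric])
    next
      case (Suc m)
      have "0\<^sub>m (dim_col (e n)) (dim_col (e n)) =
          F n * G n - 1\<^sub>m (dim_col (e n)) - 0\<^sub>m (dim_col (e n)) (dim_col (e n))"
        using arg_cong[OF k(3), of residue_mat m] K[of "Suc m"] K[of m] unfolding Suc
        by (simp add: residue_mat_mult[OF eS kc] residue_mat_minus[OF FGc one_carrier_mat]
          residue_mat_minus[OF minus_carrier_mat[OF one_carrier_mat] mult_carrier_mat[OF kc eS]]
          residue_mat_mult[OF fc gc] residue_mat_mult[OF kc eS]
          residue_mat_one minimal K_def[symmetric] F_def[symmetric] G_def[symmetric])
      then show ?thesis
        using F[of n] G[of n] by (auto simp: mat_eq_iff)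
    qed
  qed (use F[of n] G[of n] in simp)
  define Z where "Z = tor_cycles d i"
  \<comment> \<open>In degree 0 there is no kernel condition, because the augmentation
    \<open>d 0\<close> is not part of the tensored complex.\<close>
  have Z_iff: "z \<in> Z \<longleftrightarrow> z \<in> carrier_vec (dim_col (d i)) \<and>
      (\<forall>n. i = Suc n \<longrightarrow> D i *\<^sub>v z = 0\<^sub>v (dim_col (d n)))" for z
    using d by (cases i) (auto simp: Z_def tor_cycles_def mat_kernel_def D_def)
  have hom: "G i *\<^sub>v (F i *\<^sub>v z) = D (Suc i) *\<^sub>v (H i *\<^sub>v z) + z" if "z \<in> Z" for z
  proof -
    have z: "z \<in> carrier_vec (dim_col (d i))" using that by (simp add: Z_iff)
    \<comment> \<open>On the side of \<open>d\<close> the homotopy terms survive, but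
      \<open>H m * D i\<close> annihilates cycles; in degree 0 this term is absent.\<close>
    have DH: "D (Suc i) * H i *\<^sub>v z = (G i * F i - 1\<^sub>m (dim_col (d i))) *\<^sub>v z"
    proof (cases i)
      case 0
      show ?thesis
        using arg_cong[OF h(2), of residue_mat] unfolding 0
        by (simp add: residue_mat_mult[OF dS hc] residue_mat_minus[OF GFc one_carrier_mat]
          residue_mat_mult[OF gc fc] residue_mat_one H_def[symmetric] D_def[symmetric]
          F_def[symmetric] G_def[symmetric])
    next
      case (Suc m)
      have c: "G i * F i - 1\<^sub>m (dim_col (d i)) \<in> carrier_mat (dim_col (d i)) (dim_col (d i))"
        by (rule minus_carrier_mat[OF one_carrier_mat])
      have HD: "H m * D i \<in> carrier_mat (dim_col (d i)) (dim_col (d i))"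
        using H[of m] D[of m] by (simp add: Suc)
      have "D (Suc i) * H i = G i * F i - 1\<^sub>m (dim_col (d i)) - H m * D i"
        using arg_cong[OF h(3), of residue_mat m] unfolding Suc
        by (simp add: residue_mat_mult[OF dS hc] residue_mat_minus[OF GFc one_carrier_mat]
          residue_mat_minus[OF minus_carrier_mat[OF one_carrier_mat] mult_carrier_mat[OF hc dS]]
          residue_mat_mult[OF gc fc] residue_mat_mult[OF hc dS]
          residue_mat_one H_def[symmetric] D_def[symmetric]
          F_def[symmetric] G_def[symmetric])
      then have "D (Suc i) * H i *\<^sub>v z = (G i * F i - 1\<^sub>m (dim_col (d i))) *\<^sub>v z - (H m * D i) *\<^sub>v z"
        using minus_mult_distrib_mat_vec[OF c HD z] by simp
      also have "(H m * D i) *\<^sub>v z = H m *\<^sub>v (D i *\<^sub>v z)"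
        using assoc_mult_mat_vec[OF H[of m] D[of m, folded Suc]] z by (simp add: Suc)
      also have "D i *\<^sub>v z = 0\<^sub>v (dim_col (d m))"
        using that Suc by (simp add: Z_iff)
      also have "H m *\<^sub>v 0\<^sub>v (dim_col (d m)) = 0\<^sub>v (dim_col (d i))"
        unfolding Suc by (rule mult_mat_zero_vec[OF H])
      finally show ?thesis
        using c z by (simp add: mult_mat_vec_carrier)
    qed
    have GF: "G i * F i \<in> carrier_mat (dim_col (d i)) (dim_col (d i))"
      using G[of i] F[of i] by simp
    show ?thesis
    proof (rule add_uminus_diff_vec[OF z])
      show "D (Suc i) *\<^sub>v (H i *\<^sub>v z) \<in> carrier_vec (dim_col (d i))"
        using D[of i] H[of i] z by (meson mult_mat_vec_carrier)
      show "G i *\<^sub>v (F i *\<^sub>v z) \<in> carrier_vec (dim_col (d i))"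
        using G[of i] F[of i] z by (meson mult_mat_vec_carrier)
      have "D (Suc i) *\<^sub>v (H i *\<^sub>v z) = D (Suc i) * H i *\<^sub>v z"
        using assoc_mult_mat_vec[OF D H z] by simp
      also have "\<dots> = G i * F i *\<^sub>v z - 1\<^sub>m (dim_col (d i)) *\<^sub>v z"
        unfolding DH by (rule minus_mult_distrib_mat_vec[OF GF one_carrier_mat z])
      also have "\<dots> = G i *\<^sub>v (F i *\<^sub>v z) - z"
        using assoc_mult_mat_vec[OF G F z] z by simp
      finally show "D (Suc i) *\<^sub>v (H i *\<^sub>v z) = G i *\<^sub>v (F i *\<^sub>v z) - z" .
    qed
  qed
  have "vectorspace.dim class_ring
    (quotient_module (module_vec TYPE('k) (dim_col (d i)) \<lparr> carrier := Z \<rparr>)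
      {D (Suc i) *\<^sub>v w | w. w \<in> carrier_vec (dim_col (d (Suc i)))}) = dim_col (e i)"
  proof (rule dim_quotient_module[OF D F G H FG FD])
    show "Z \<subseteq> carrier_vec (dim_col (d i))"
      by (auto simp: Z_iff)
    show "x + y \<in> Z" if "x \<in> Z" "y \<in> Z" for x y
      using that mult_add_distrib_mat_vec[OF D, of x _ y] by (auto simp: Z_iff)
    show "a \<cdot>\<^sub>v x \<in> Z" if "x \<in> Z" for a x
      using that mult_mat_vec[OF D, of x _ a] by (auto simp: Z_iff)
    show "D (Suc i) *\<^sub>v w \<in> Z" if "w \<in> carrier_vec (dim_col (d (Suc i)))" for w
      unfolding Z_iff
    proof (intro conjI allI impI)
      show "D (Suc i) *\<^sub>v w \<in> carrier_vec (dim_col (d i))"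
        by (rule mult_mat_vec_carrier[OF D that])
      fix n assume n: "i = Suc n"
      have "D i *\<^sub>v (D (Suc i) *\<^sub>v w) = D i * D (Suc i) *\<^sub>v w"
        using assoc_mult_mat_vec[OF D D that[unfolded n]] n by simp
      then show "D i *\<^sub>v (D (Suc i) *\<^sub>v w) = 0\<^sub>v (dim_col (d n))"
        using DD[of n] that by (simp add: n zero_mult_mat_vec)
    qed
    show "G i *\<^sub>v u \<in> Z" if "u \<in> carrier_vec (dim_col (e i))" for u
      unfolding Z_iff
    proof (intro conjI allI impI)
      show "G i *\<^sub>v u \<in> carrier_vec (dim_col (d i))"
        by (rule mult_mat_vec_carrier[OF G that])
      fix n assume n: "i = Suc n"
      have "D i *\<^sub>v (G i *\<^sub>v u) = D i * G i *\<^sub>v u"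
        using assoc_mult_mat_vec[OF D G that[unfolded n]] n by simp
      then show "D i *\<^sub>v (G i *\<^sub>v u) = 0\<^sub>v (dim_col (d n))"
        using DG[of n] that by (simp add: n zero_mult_mat_vec)
    qed
    show "G i *\<^sub>v (F i *\<^sub>v z) = D (Suc i) *\<^sub>v (H i *\<^sub>v z) + z" if "z \<in> Z" for z
      by (rule hom[OF that])
  qed
  then show ?thesis
    by (simp add: tor_def Z_def tor_boundaries_def D_def)
qed

section \<open>Homogenized complexes\<close>

text \<open>Divisibility of monomials. Where it holds, the truncated difference \<open>b - a\<close>
  is the exponent of the quotient.\<close>

definition exponent_le :: "('v \<Rightarrow>\<^sub>0 nat) \<Rightarrow> ('v \<Rightarrow>\<^sub>0 nat) \<Rightarrow> bool" where
  "exponent_le a b \<longleftrightarrow> (\<forall>x. Poly_Mapping.lookup a x \<le> Poly_Mapping.lookup b x)"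

lemma exponent_le_trans: "exponent_le a b \<Longrightarrow> exponent_le b c \<Longrightarrow> exponent_le a c"
  unfolding exponent_le_def by (meson order_trans)

lemma exponent_le_add: "exponent_le a (a + b)" "exponent_le a (b + a)"
  by (simp_all add: exponent_le_def lookup_add)

lemma exponent_le_add_diff: "exponent_le a b \<Longrightarrow> a + (b - a) = b"
  by (rule poly_mapping_eqI) (simp add: exponent_le_def lookup_add lookup_minus)

lemma exponent_le_add_iff: "exponent_le (a + c) (b + c) \<longleftrightarrow> exponent_le a b"
  by (simp add: exponent_le_def lookup_add)

lemma lookup_single_times:
  fixes f :: "('v \<Rightarrow>\<^sub>0 nat) \<Rightarrow>\<^sub>0 'k::semiring_0"
  shows "Poly_Mapping.lookup (Poly_Mapping.single v c * f) m =
    (if exponent_le v m then c * Poly_Mapping.lookup f (m - v) else 0)"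
proof (cases "exponent_le v m")
  case True
  then show ?thesis
    using lookup_single_times_add[of v c f "m - v"] by (simp add: exponent_le_add_diff)
next
  case False
  then show ?thesis
    using lookup_single_times_not_add[of m v c f] exponent_le_add(1)[of v] by fastforce
qed

lemma keys_diff_exponent: "Poly_Mapping.keys (a - b :: 'v \<Rightarrow>\<^sub>0 nat) \<subseteq> Poly_Mapping.keys a"
  by (auto simp: in_keys_iff lookup_minus)

text \<open>The part of multidegree \<open>M\<close> of an element of the free module whose basis vectors \<open>y\<close> have
  degree \<open>dg y\<close>.\<close>

definition graded_part ::
    "('y \<Rightarrow> 'v \<Rightarrow>\<^sub>0 nat) \<Rightarrow> ('y \<Rightarrow> ('v, 'k::field) mpoly) \<Rightarrow> ('v \<Rightarrow>\<^sub>0 nat) \<Rightarrow> 'y \<Rightarrow> 'k" where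
  "graded_part dg f M y =
    (if exponent_le (dg y) M then Poly_Mapping.lookup (f y) (M - dg y) else 0)"

text \<open>Multiplying the scalar \<open>s y\<close> by the monomial of exponent
  \<open>dg y - a\<close> makes the row homogeneous, so that in multidegree \<open>m + a\<close> it
  acts as the scalar row \<open>s\<close>. The divisibility hypothesis ensures that the truncated
  difference is a true quotient wherever \<open>s y\<close> is nonzero.\<close>

lemma lookup_homogenized_sum:
  fixes f :: "'y \<Rightarrow> ('v, 'k::field) mpoly"
  assumes "\<And>y. y \<in> Y \<Longrightarrow> s y \<noteq> 0 \<Longrightarrow> exponent_le a (dg y)"
  shows "Poly_Mapping.lookup (\<Sum>y\<in>Y. Poly_Mapping.single (dg y - a) (s y) * f y) m =
    (\<Sum>y\<in>Y. s y * graded_part dg f (m + a) y)"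
  unfolding lookup_sum
proof (rule sum.cong[OF refl])
  fix y assume y: "y \<in> Y"
  show "Poly_Mapping.lookup (Poly_Mapping.single (dg y - a) (s y) * f y) m =
      s y * graded_part dg f (m + a) y"
  proof (cases "s y = 0")
    case False
    then have a: "a + (dg y - a) = dg y"
      using assms y exponent_le_add_diff by blast
    then have "exponent_le (dg y) (m + a) \<longleftrightarrow> exponent_le (dg y - a) m"
      using exponent_le_add_iff[of "dg y - a" a m] by (simp add: add.commute)
    moreover have "m + a - dg y = m - (dg y - a)"
      using a by (metis add.commute add_diff_cancel_right' diff_diff_eq)
    ultimately show ?thesis
      by (simp add: lookup_single_times graded_part_def)
  qed simp
qed

lemma single_sum: "Poly_Mapping.single k (sum f A) = (\<Sum>a\<in>A. Poly_Mapping.single k (f a))"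
  by (induction A rule: infinite_finite_induct) (simp_all add: single_add)

text \<open>The quotients of labels telescope: their product along \<open>a\<close>,
  \<open>degY y\<close>, \<open>degZ z\<close> does not depend on \<open>y\<close>. The sum over
  \<open>y\<close> is therefore one monomial times the scalar sum, which \<open>st\<close> makes
  zero.\<close>

lemma homogenized_complex:
  fixes s :: "'y \<Rightarrow> 'k::field" and t :: "'y \<Rightarrow> 'z \<Rightarrow> 'k"
  assumes s: "\<And>y. y \<in> Y \<Longrightarrow> s y \<noteq> 0 \<Longrightarrow> exponent_le a (degY y)"
    and t: "\<And>y z. y \<in> Y \<Longrightarrow> z \<in> Z \<Longrightarrow> t y z \<noteq> 0 \<Longrightarrow> exponent_le (degY y) (degZ z)"
    and st: "\<And>z. z \<in> Z \<Longrightarrow> (\<Sum>y\<in>Y. s y * t y z) = 0"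
  shows "(\<Sum>y\<in>Y. Poly_Mapping.single (degY y - a) (s y) *
    (\<Sum>z\<in>Z. Poly_Mapping.single (degZ z - degY y) (t y z) * g z)) = (0 :: ('v, 'k) mpoly)"
proof -
  have single: "Poly_Mapping.single (degY y - a) (s y) * Poly_Mapping.single (degZ z - degY y) (t y z) =
      Poly_Mapping.single (degZ z - a) (s y * t y z)" if "y \<in> Y" "z \<in> Z" for y z
  proof (cases "s y = 0 \<or> t y z = 0")
    case False
    then have le: "exponent_le a (degY y)" "exponent_le (degY y) (degZ z)"
      using s t that by auto
    have "(degY y - a) + (degZ z - degY y) = degZ z - a"
      using le by (intro poly_mapping_eqI) (simp add: lookup_add lookup_minus exponent_le_def)
    then show ?thesis
      by (simp add: mult_single)
  qed auto
  have "(\<Sum>y\<in>Y. Poly_Mapping.single (degY y - a) (s y) *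
      (\<Sum>z\<in>Z. Poly_Mapping.single (degZ z - degY y) (t y z) * g z)) =
      (\<Sum>y\<in>Y. \<Sum>z\<in>Z. Poly_Mapping.single (degZ z - a) (s y * t y z) * g z)"
    using single by (auto simp: sum_distrib_left mult.assoc[symmetric] intro!: sum.cong)
  also have "\<dots> = (\<Sum>z\<in>Z. Poly_Mapping.single (degZ z - a) (\<Sum>y\<in>Y. s y * t y z) * g z)"
    by (subst sum.swap) (simp add: sum_distrib_right[symmetric] single_sum)
  also have "\<dots> = 0"
    by (simp add: st)
  finally show ?thesis .
qed

text \<open>Exactness can be tested in each multidegree \<open>M\<close>, where the complex is that of the cells of
  degree at most \<open>M\<close>.\<close>

lemma homogenized_exact:
  fixes s :: "'x \<Rightarrow> 'y \<Rightarrow> 'k::field" and t :: "'y \<Rightarrow> 'z \<Rightarrow> 'k"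
    and degY :: "'y \<Rightarrow> 'v \<Rightarrow>\<^sub>0 nat"
  assumes fin: "finite Y" "finite Z"
    and s: "\<And>x y. x \<in> X \<Longrightarrow> y \<in> Y \<Longrightarrow> s x y \<noteq> 0 \<Longrightarrow> exponent_le (degX x) (degY y)"
    and t: "\<And>y z. y \<in> Y \<Longrightarrow> z \<in> Z \<Longrightarrow> t y z \<noteq> 0 \<Longrightarrow> exponent_le (degY y) (degZ z)"
    and exact: "\<And>M u. (\<And>y. u y \<noteq> 0 \<Longrightarrow> y \<in> Y \<and> exponent_le (degY y) M) \<Longrightarrow>
      (\<And>x. x \<in> X \<Longrightarrow> (\<Sum>y\<in>Y. s x y * u y) = 0) \<Longrightarrow>
      \<exists>w. (\<forall>z. w z \<noteq> 0 \<longrightarrow> z \<in> Z \<and> exponent_le (degZ z) M) \<and> (\<forall>y\<in>Y. u y = (\<Sum>z\<in>Z. t y z * w z))"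
    and degY: "\<And>y. y \<in> Y \<Longrightarrow> Poly_Mapping.keys (degY y) \<subseteq> V"
    and f: "\<And>y. y \<in> Y \<Longrightarrow> f y \<in> carrier (poly_ring V)"
    and cycle: "\<And>x. x \<in> X \<Longrightarrow>
      (\<Sum>y\<in>Y. Poly_Mapping.single (degY y - degX x) (s x y) * f y) = 0"
  shows "\<exists>g. (\<forall>z. g z \<in> carrier (poly_ring V)) \<and>
    (\<forall>y\<in>Y. f y = (\<Sum>z\<in>Z. Poly_Mapping.single (degZ z - degY y) (t y z) * g z))"
proof -
  define u where "u M y = (if y \<in> Y then graded_part degY f M y else 0)" for M y
  \<comment> \<open>The finitely many multidegrees in which \<open>f\<close> has a nonzero part.
    Only the solutions for these enter \<open>g\<close>, so that \<open>g\<close> has polynomial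
    entries.\<close>
  define Ms where "Ms = (\<Union>y\<in>Y. (\<lambda>m. m + degY y) ` Poly_Mapping.keys (f y))"
  have finMs: "finite Ms"
    using fin by (simp add: Ms_def)
  have "\<exists>w. (\<forall>z. w z \<noteq> 0 \<longrightarrow> z \<in> Z \<and> exponent_le (degZ z) M) \<and>
      (\<forall>y\<in>Y. u M y = (\<Sum>z\<in>Z. t y z * w z))" for M
  proof (rule exact)
    show "y \<in> Y \<and> exponent_le (degY y) M" if "u M y \<noteq> 0" for y
      using that by (auto simp: u_def graded_part_def split: if_splits)
    fix x assume x: "x \<in> X"
    show "(\<Sum>y\<in>Y. s x y * u M y) = 0"
    proof (cases "exponent_le (degX x) M")
      case True
      have "(\<Sum>y\<in>Y. s x y * u M y) = (\<Sum>y\<in>Y. s x y * graded_part degY f (M - degX x + degX x) y)"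
        using exponent_le_add_diff[OF True] by (intro sum.cong) (auto simp: u_def add.commute)
      also have "\<dots> = Poly_Mapping.lookup
          (\<Sum>y\<in>Y. Poly_Mapping.single (degY y - degX x) (s x y) * f y) (M - degX x)"
        using s[OF x] by (intro lookup_homogenized_sum[symmetric])
      finally show ?thesis
        by (simp add: cycle[OF x])
    next
      case False
      \<comment> \<open>If the label of \<open>x\<close> does not divide \<open>M\<close>, no label
        above it does, so no cell in the support of \<open>u M\<close> meets
        \<open>x\<close>.\<close>
      have "s x y * u M y = 0" if "y \<in> Y" for y
        using s[OF x that] False exponent_le_trans[of "degX x" "degY y" M]
        by (auto simp: u_def graded_part_def)
      then show ?thesis
        by (simp add: sum.neutral)
    qed
  qed
  then obtain w where w: "\<And>M z. w M z \<noteq> 0 \<Longrightarrow> z \<in> Z \<and> exponent_le (degZ z) M"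
    "\<And>M y. y \<in> Y \<Longrightarrow> u M y = (\<Sum>z\<in>Z. t y z * w M z)"
    by metis
  \<comment> \<open>The part of \<open>g\<close> in multidegree \<open>M\<close> has to be
    \<open>w M\<close>; on the basis vector \<open>z\<close> this means the coefficient
    \<open>w M z\<close> at the exponent \<open>M - degZ z\<close>.\<close>
  define g where "g z = (\<Sum>M\<in>Ms. Poly_Mapping.single (M - degZ z) (w M z))" for z
  have lookup_g: "Poly_Mapping.lookup (g z) m = (if m + degZ z \<in> Ms then w (m + degZ z) z else 0)" for z m
  proof -
    have "Poly_Mapping.lookup (g z) m = (\<Sum>M\<in>Ms. Poly_Mapping.lookup (Poly_Mapping.single (M - degZ z) (w M z)) m)"
      by (simp add: g_def lookup_sum)
    also have "\<dots> = (\<Sum>M\<in>Ms. if M = m + degZ z then w M z else 0)"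
    proof (rule sum.cong[OF refl])
      fix M
      show "Poly_Mapping.lookup (Poly_Mapping.single (M - degZ z) (w M z)) m =
          (if M = m + degZ z then w M z else 0)"
      proof (cases "w M z = 0")
        case False
        then have "degZ z + (M - degZ z) = M"
          using w(1) exponent_le_add_diff by blast
        then have "M - degZ z = m \<longleftrightarrow> M = m + degZ z"
          by (metis add.commute add_diff_cancel_right')
        then show ?thesis
          by (simp add: lookup_single when_def)
      qed auto
    qed
    finally show ?thesis
      using finMs by simp
  qed
  have w_eq: "(\<Sum>z\<in>Z. t y z * graded_part degZ g M z) = u M y" if y: "y \<in> Y" for M y
  proof (cases "M \<in> Ms")
    case True
    have "graded_part degZ g M z = w M z" for z
    proof (cases "exponent_le (degZ z) M")
      case le: True
      then have "M - degZ z + degZ z = M"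
        using exponent_le_add_diff by (metis add.commute)
      then show ?thesis
        using le True by (simp add: graded_part_def lookup_g)
    qed (use w(1) in \<open>auto simp: graded_part_def\<close>)
    then show ?thesis
      using w(2)[OF y] by simp
  next
    case False
    have "graded_part degZ g M z = 0" for z
      using False exponent_le_add_diff[of "degZ z" M] by (auto simp: graded_part_def lookup_g add.commute)
    moreover have "u M y = 0"
    proof (rule ccontr)
      assume "u M y \<noteq> 0"
      then have "exponent_le (degY y) M" "M - degY y \<in> Poly_Mapping.keys (f y)"
        by (auto simp: u_def graded_part_def in_keys_iff split: if_splits)
      then have "M \<in> (\<lambda>m. m + degY y) ` Poly_Mapping.keys (f y)"
        using exponent_le_add_diff[of "degY y" M] by (metis add.commute imageI)
      then show False
        using False y by (auto simp: Ms_def)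
    qed
    ultimately show ?thesis
      by simp
  qed
  have "f y = (\<Sum>z\<in>Z. Poly_Mapping.single (degZ z - degY y) (t y z) * g z)" if y: "y \<in> Y" for y
  proof (rule poly_mapping_eqI)
    fix m
    have "Poly_Mapping.lookup (\<Sum>z\<in>Z. Poly_Mapping.single (degZ z - degY y) (t y z) * g z) m =
        (\<Sum>z\<in>Z. t y z * graded_part degZ g (m + degY y) z)"
      using t[OF y] by (rule lookup_homogenized_sum)
    also have "\<dots> = Poly_Mapping.lookup (f y) m"
      using w_eq[OF y] y by (simp add: u_def graded_part_def exponent_le_add)
    finally show "Poly_Mapping.lookup (f y) m =
        Poly_Mapping.lookup (\<Sum>z\<in>Z. Poly_Mapping.single (degZ z - degY y) (t y z) * g z) m"
      by simp
  qed
  moreover have "g z \<in> carrier (poly_ring V)" for z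
    unfolding g_def
  proof (intro poly_ring_sum poly_ring_single order_trans[OF keys_diff_exponent])
    fix M assume "M \<in> Ms"
    then obtain y m where y: "y \<in> Y" "m \<in> Poly_Mapping.keys (f y)" "M = m + degY y"
      by (auto simp: Ms_def)
    then show "Poly_Mapping.keys M \<subseteq> V"
      using keys_add[of m "degY y"] f[OF y(1)] degY[OF y(1)] by (auto simp: in_poly_ring_iff)
  qed
  ultimately show ?thesis
    by blast
qed

text \<open>The matrix shape of a cellular resolution: a scalar incidence matrix whose entries are
  multiplied by the quotients of the labels of column and row. Lists fix the order of the cells,
  since matrices are indexed by numbers.\<close>

definition homogenized_mat ::
    "'x list \<Rightarrow> 'y list \<Rightarrow> ('x \<Rightarrow> 'v \<Rightarrow>\<^sub>0 nat) \<Rightarrow> ('y \<Rightarrow> 'v \<Rightarrow>\<^sub>0 nat) \<Rightarrow> ('x \<Rightarrow> 'y \<Rightarrow> 'k) \<Rightarrow>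
      ('v, 'k::field) mpoly mat" where
  "homogenized_mat xs ys degX degY s = mat (length xs) (length ys)
    (\<lambda>(i, j). Poly_Mapping.single (degY (ys ! j) - degX (xs ! i)) (s (xs ! i) (ys ! j)))"

lemma dim_homogenized_mat [simp]:
  "dim_row (homogenized_mat xs ys degX degY s) = length xs"
  "dim_col (homogenized_mat xs ys degX degY s) = length ys"
  by (simp_all add: homogenized_mat_def)

lemma homogenized_mat_poly_mat:
  assumes "\<And>y. y \<in> set ys \<Longrightarrow> Poly_Mapping.keys (degY y) \<subseteq> V"
  shows "homogenized_mat xs ys degX degY s \<in> poly_mat V (length xs) (length ys)"
  unfolding poly_mat_def homogenized_mat_def
proof (intro CollectI conjI allI impI)
  fix i j assume "i < length xs" "j < length ys"
  then show "mat (length xs) (length ys) (\<lambda>(i, j). Poly_Mapping.single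
      (degY (ys ! j) - degX (xs ! i)) (s (xs ! i) (ys ! j))) $$ (i, j) \<in> carrier (poly_ring V)"
    using order_trans[OF keys_diff_exponent assms[of "ys ! j"]] by (simp add: poly_ring_single)
qed simp

lemma homogenized_mat_mult_vec:
  assumes "distinct ys" "i < length xs"
  shows "(homogenized_mat xs ys degX degY s *\<^sub>v vec (length ys) (\<lambda>j. f (ys ! j))) $ i =
    (\<Sum>y\<in>set ys. Poly_Mapping.single (degY y - degX (xs ! i)) (s (xs ! i) y) * f y)"
proof -
  have "(homogenized_mat xs ys degX degY s *\<^sub>v vec (length ys) (\<lambda>j. f (ys ! j))) $ i =
      (\<Sum>j\<in>{0..<length ys}. Poly_Mapping.single (degY (ys ! j) - degX (xs ! i)) (s (xs ! i) (ys ! j)) * f (ys ! j))"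
    using assms(2) by (simp add: homogenized_mat_def scalar_prod_def)
  also have "\<dots> = (\<Sum>y\<in>set ys. Poly_Mapping.single (degY y - degX (xs ! i)) (s (xs ! i) y) * f y)"
    using bij_betw_nth[OF assms(1) _ refl, of "{0..<length ys}"]
    by (intro sum.reindex_bij_betw) (auto simp: atLeast0LessThan)
  finally show ?thesis .
qed

text \<open>Vectors can be treated as functions on cells, since distinctness gives each cell a
  unique position.\<close>

lemma vec_of_cells:
  assumes "distinct ys" "v \<in> carrier_vec (length ys)"
  shows "\<exists>f. v = vec (length ys) (\<lambda>j. f (ys ! j))"
proof (intro exI eq_vecI)
  let ?f = "\<lambda>y. v $ (THE j. j < length ys \<and> ys ! j = y)"
  fix j assume "j < dim_vec (vec (length ys) (\<lambda>j. ?f (ys ! j)))"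
  then have j: "j < length ys" by simp
  then have "(THE i. i < length ys \<and> ys ! i = ys ! j) = j"
    using assms(1) by (auto simp: nth_eq_iff_index_eq)
  then show "v $ j = vec (length ys) (\<lambda>j. ?f (ys ! j)) $ j"
    using j by simp
qed (use assms in simp)

text \<open>One inclusion is \<open>homogenized_exact\<close>, the other
  \<open>homogenized_complex\<close>. All that remains to be supplied about a particular complex is
  scalar: a zero composite, and exactness among the cells of degree at most
  \<open>M\<close>.\<close>

lemma homogenized_mat_exact:
  fixes s :: "'x \<Rightarrow> 'y \<Rightarrow> 'k::field" and t :: "'y \<Rightarrow> 'z \<Rightarrow> 'k"
    and degY :: "'y \<Rightarrow> 'v \<Rightarrow>\<^sub>0 nat"
  assumes dist: "distinct ys" "distinct zs"
    and s: "\<And>x y. x \<in> set xs \<Longrightarrow> y \<in> set ys \<Longrightarrow> s x y \<noteq> 0 \<Longrightarrow> exponent_le (degX x) (degY y)"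
    and t: "\<And>y z. y \<in> set ys \<Longrightarrow> z \<in> set zs \<Longrightarrow> t y z \<noteq> 0 \<Longrightarrow> exponent_le (degY y) (degZ z)"
    and complex: "\<And>x z. x \<in> set xs \<Longrightarrow> z \<in> set zs \<Longrightarrow> (\<Sum>y\<in>set ys. s x y * t y z) = 0"
    and exact: "\<And>M u. (\<And>y. u y \<noteq> 0 \<Longrightarrow> y \<in> set ys \<and> exponent_le (degY y) M) \<Longrightarrow>
      (\<And>x. x \<in> set xs \<Longrightarrow> (\<Sum>y\<in>set ys. s x y * u y) = 0) \<Longrightarrow>
      \<exists>w. (\<forall>z. w z \<noteq> 0 \<longrightarrow> z \<in> set zs \<and> exponent_le (degZ z) M) \<and>
        (\<forall>y\<in>set ys. u y = (\<Sum>z\<in>set zs. t y z * w z))"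
    and degY: "\<And>y. y \<in> set ys \<Longrightarrow> Poly_Mapping.keys (degY y) \<subseteq> V"
    and degZ: "\<And>z. z \<in> set zs \<Longrightarrow> Poly_Mapping.keys (degZ z) \<subseteq> V"
  shows "{v \<in> poly_vec V (length ys). homogenized_mat xs ys degX degY s *\<^sub>v v = 0\<^sub>v (length xs)} =
    {homogenized_mat ys zs degY degZ t *\<^sub>v w | w. w \<in> poly_vec V (length zs)}"
proof (intro equalityI subsetI)
  fix v assume "v \<in> {v \<in> poly_vec V (length ys).
    homogenized_mat xs ys degX degY s *\<^sub>v v = 0\<^sub>v (length xs)}"
  then have v: "v \<in> poly_vec V (length ys)" "homogenized_mat xs ys degX degY s *\<^sub>v v = 0\<^sub>v (length xs)"
    by auto
  then obtain f where f: "v = vec (length ys) (\<lambda>j. f (ys ! j))"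
    using vec_of_cells[OF dist(1)] by (auto simp: poly_vec_def)
  have "\<exists>g. (\<forall>z. g z \<in> carrier (poly_ring V)) \<and>
      (\<forall>y\<in>set ys. f y = (\<Sum>z\<in>set zs. Poly_Mapping.single (degZ z - degY y) (t y z) * g z))"
  proof (rule homogenized_exact[OF finite_set finite_set s t exact degY])
    show "f y \<in> carrier (poly_ring V)" if "y \<in> set ys" for y
      using that v(1) by (auto simp: f poly_vec_def in_set_conv_nth)
    show "(\<Sum>y\<in>set ys. Poly_Mapping.single (degY y - degX x) (s x y) * f y) = 0" if x: "x \<in> set xs" for x
    proof -
      obtain i where i: "i < length xs" "x = xs ! i"
        using x by (auto simp: in_set_conv_nth)
      then show ?thesis
        using arg_cong[OF v(2), of "\<lambda>v. v $ i"] homogenized_mat_mult_vec[OF dist(1) i(1), of degX degY s f]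
        by (simp add: f)
    qed
  qed
  then obtain g where g: "\<And>z. g z \<in> carrier (poly_ring V)"
    "\<And>y. y \<in> set ys \<Longrightarrow> f y = (\<Sum>z\<in>set zs. Poly_Mapping.single (degZ z - degY y) (t y z) * g z)"
    by blast
  have "v = homogenized_mat ys zs degY degZ t *\<^sub>v vec (length zs) (\<lambda>j. g (zs ! j))"
  proof (rule eq_vecI)
    fix i assume "i < dim_vec (homogenized_mat ys zs degY degZ t *\<^sub>v vec (length zs) (\<lambda>j. g (zs ! j)))"
    then have i: "i < length ys" by simp
    show "v $ i = (homogenized_mat ys zs degY degZ t *\<^sub>v vec (length zs) (\<lambda>j. g (zs ! j))) $ i"
      unfolding homogenized_mat_mult_vec[OF dist(2) i] using i g(2)[of "ys ! i"] by (simp add: f)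
  qed (simp add: f)
  moreover have "vec (length zs) (\<lambda>j. g (zs ! j)) \<in> poly_vec V (length zs)"
    using g(1) by (simp add: poly_vec_def)
  ultimately show "v \<in> {homogenized_mat ys zs degY degZ t *\<^sub>v w | w. w \<in> poly_vec V (length zs)}"
    by blast
next
  fix v assume "v \<in> {homogenized_mat ys zs degY degZ t *\<^sub>v w | w. w \<in> poly_vec V (length zs)}"
  then obtain w where w: "w \<in> poly_vec V (length zs)" "v = homogenized_mat ys zs degY degZ t *\<^sub>v w"
    by blast
  then obtain g where g: "w = vec (length zs) (\<lambda>j. g (zs ! j))"
    using vec_of_cells[OF dist(2)] by (auto simp: poly_vec_def)
  define f where "f y = (\<Sum>z\<in>set zs. Poly_Mapping.single (degZ z - degY y) (t y z) * g z)" for y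
  have v: "v = vec (length ys) (\<lambda>j. f (ys ! j))"
    unfolding w(2) g
  proof (rule eq_vecI)
    fix i assume "i < dim_vec (vec (length ys) (\<lambda>j. f (ys ! j)))"
    then have i: "i < length ys" by simp
    show "(homogenized_mat ys zs degY degZ t *\<^sub>v vec (length zs) (\<lambda>j. g (zs ! j))) $ i =
        vec (length ys) (\<lambda>j. f (ys ! j)) $ i"
      unfolding homogenized_mat_mult_vec[OF dist(2) i] using i by (simp add: f_def)
  qed simp
  have "homogenized_mat xs ys degX degY s *\<^sub>v v = 0\<^sub>v (length xs)"
    unfolding v
  proof (rule eq_vecI)
    fix i assume "i < dim_vec (0\<^sub>v (length xs) :: ('v, 'k) mpoly vec)"
    then have i: "i < length xs" by simp
    have "(homogenized_mat xs ys degX degY s *\<^sub>v vec (length ys) (\<lambda>j. f (ys ! j))) $ i =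
        (\<Sum>y\<in>set ys. Poly_Mapping.single (degY y - degX (xs ! i)) (s (xs ! i) y) * f y)"
      by (rule homogenized_mat_mult_vec[OF dist(1) i])
    also have "\<dots> = 0"
      unfolding f_def
      by (rule homogenized_complex[OF s[OF nth_mem[OF i]] t complex[OF nth_mem[OF i]]])
    finally show "(homogenized_mat xs ys degX degY s *\<^sub>v vec (length ys) (\<lambda>j. f (ys ! j))) $ i =
        0\<^sub>v (length xs) $ i"
      using i by simp
  qed simp
  moreover have "v \<in> poly_vec V (length ys)"
    unfolding w(2) by (rule poly_mat_mult_vec[OF homogenized_mat_poly_mat[OF degZ] w(1)])
  ultimately show "v \<in> {v \<in> poly_vec V (length ys).
      homogenized_mat xs ys degX degY s *\<^sub>v v = 0\<^sub>v (length xs)}"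
    by simp
qed

section \<open>The cube complex of the lattice of ideals\<close>

text \<open>The poset is replaced by the positions in a labelling, so that \<open><\<close> on
  numbers is a linear extension. It supplies antisymmetry, the orientation signs, and a canonical
  apex for contracting simplices.\<close>

locale labelled_poset =
  fixes J :: "nat set" and le :: "nat \<Rightarrow> nat \<Rightarrow> bool"
  assumes finite_J: "finite J"
    and le_refl: "a \<in> J \<Longrightarrow> le a a"
    and le_trans: "a \<in> J \<Longrightarrow> b \<in> J \<Longrightarrow> c \<in> J \<Longrightarrow> le a b \<Longrightarrow> le b c \<Longrightarrow> le a c"
    and le_imp_less_eq: "a \<in> J \<Longrightarrow> b \<in> J \<Longrightarrow> le a b \<Longrightarrow> a \<le> b"
begin

definition ideals :: "nat set set" where
  "ideals = {\<alpha>. \<alpha> \<subseteq> J \<and> (\<forall>a \<in> \<alpha>. \<forall>b \<in> J. le b a \<longrightarrow> b \<in> \<alpha>)}"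

definition maxima :: "nat set \<Rightarrow> nat set" where
  "maxima \<alpha> = {a \<in> \<alpha>. \<forall>b \<in> \<alpha>. le a b \<longrightarrow> b = a}"

text \<open>The cell \<open>(\<alpha>, S)\<close> is the cube in the lattice of ideals with top \<open>\<alpha>\<close> and bottom \<open>\<alpha> - S\<close>.\<close>

definition cells :: "nat \<Rightarrow> (nat set \<times> nat set) set" where
  "cells n = {(\<alpha>, S). \<alpha> \<in> ideals \<and> S \<subseteq> maxima \<alpha> \<and> card S = n}"

text \<open>The sign with which the face \<open>T\<close> occurs in the boundary of the simplex
  \<open>insert q T\<close>, vertices being ordered by size.\<close>

definition position_sign :: "nat \<Rightarrow> nat set \<Rightarrow> 'k::comm_ring_1" where
  "position_sign q T = (- 1) ^ card {s \<in> T. s < q}"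

text \<open>The cubes having \<open>(\<beta>, T)\<close> as a facet are \<open>(insert q \<beta>, insert q T)\<close>: for \<open>q \<in> \<beta>\<close> it is the upper
  facet in direction \<open>q\<close>, for \<open>q \<notin> \<beta>\<close> the lower one.\<close>

definition bd :: "(nat set \<times> nat set \<Rightarrow> 'k::comm_ring_1) \<Rightarrow> nat set \<times> nat set \<Rightarrow> 'k" where
  "bd u = (\<lambda>(\<beta>, T). \<Sum>q \<in> J - T. position_sign q T * (if q \<in> \<beta> then 1 else - 1) *
    u (insert q \<beta>, insert q T))"

text \<open>The matrix entry of \<open>bd\<close>, read off from the indicator function of
  \<open>z\<close>. With \<open>bd\<close> as the primitive notion, chains are plain functions and
  the boundary is defined without reference to a list of cells.\<close>

definition incidence :: "nat set \<times> nat set \<Rightarrow> nat set \<times> nat set \<Rightarrow> 'k::comm_ring_1" where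
  "incidence y z = bd (\<lambda>c. if c = z then 1 else 0) y"

lemma idealsD: "\<alpha> \<in> ideals \<Longrightarrow> \<alpha> \<subseteq> J" "\<alpha> \<in> ideals \<Longrightarrow> finite \<alpha>"
  using finite_J by (auto simp: ideals_def intro: finite_subset)

lemma finite_ideals: "finite ideals"
  using finite_J by (auto simp: ideals_def intro: finite_subset[of _ "Pow J"])

lemma maxima_subset: "maxima \<alpha> \<subseteq> \<alpha>"
  by (auto simp: maxima_def)

lemma cellsD:
  assumes "(\<alpha>, S) \<in> cells n"
  shows "\<alpha> \<in> ideals" "S \<subseteq> maxima \<alpha>" "card S = n" "finite \<alpha>" "finite S" "S \<subseteq> J" "\<alpha> \<subseteq> J"
proof -
  show *: "\<alpha> \<in> ideals" "S \<subseteq> maxima \<alpha>" "card S = n"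
    using assms by (auto simp: cells_def)
  show "finite \<alpha>" "\<alpha> \<subseteq> J"
    using idealsD[OF *(1)] by auto
  then show "finite S" "S \<subseteq> J"
    using *(2) maxima_subset[of \<alpha>] by (auto intro: finite_subset)
qed

lemma finite_cells: "finite (cells n)"
  by (rule finite_subset[of _ "Pow J \<times> Pow J"]) (use finite_J in \<open>auto dest: cellsD\<close>)

text \<open>Among the elements above \<open>a\<close>, the numerically largest is maximal in the
  poset because the labelling is a linear extension.\<close>

lemma exists_maximum_above:
  assumes "\<alpha> \<in> ideals" "a \<in> \<alpha>"
  shows "\<exists>m \<in> maxima \<alpha>. le a m"
proof -
  let ?U = "{b \<in> \<alpha>. le a b}"
  have J: "\<alpha> \<subseteq> J" and fin: "finite ?U" and ne: "?U \<noteq> {}"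
    using idealsD[OF assms(1)] assms le_refl by auto
  then have m: "Max ?U \<in> \<alpha>" "le a (Max ?U)"
    using Max_in[OF fin ne] by auto
  have "b = Max ?U" if b: "b \<in> \<alpha>" "le (Max ?U) b" for b
  proof (rule antisym)
    have "le a b"
      using le_trans[of a "Max ?U" b] m b J assms(2) by auto
    then show "b \<le> Max ?U"
      using fin b by simp
    show "Max ?U \<le> b"
      using le_imp_less_eq[of "Max ?U" b] b m J by auto
  qed
  then show ?thesis
    using m by (auto simp: maxima_def)
qed

text \<open>The upper facet keeps its top. For the lower one, \<open>q\<close> is maximal in the
  top, so deleting it leaves an ideal, in which the other directions remain maximal.\<close>

lemma facet_in_cells:
  assumes "(insert q \<beta>, insert q T) \<in> cells (Suc n)" "q \<notin> T"
  shows "(\<beta>, T) \<in> cells n"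
proof -
  note c = cellsD[OF assms(1)]
  have T: "card T = n"
    using c(3,5) assms(2) by simp
  show ?thesis
  proof (cases "q \<in> \<beta>")
    case True
    then show ?thesis
      using c T by (auto simp: cells_def insert_absorb)
  next
    case False
    have q: "\<forall>b \<in> \<beta>. \<not> le q b"
      using c(2) False by (auto simp: maxima_def)
    have "\<beta> \<in> ideals"
      unfolding ideals_def
    proof (intro CollectI conjI ballI impI)
      show "\<beta> \<subseteq> J"
        using c(7) by simp
      fix a b assume ab: "a \<in> \<beta>" "b \<in> J" "le b a"
      then have "b \<in> insert q \<beta>"
        using c(1) unfolding ideals_def by blast
      then show "b \<in> \<beta>"
        using q ab by blast
    qed
    moreover have "T \<subseteq> maxima \<beta>"
      using c(2) assms(2) by (auto simp: maxima_def)
    ultimately show ?thesis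
      using T by (simp add: cells_def)
  qed
qed

lemma bd_supported:
  assumes "\<And>c. u c \<noteq> 0 \<Longrightarrow> c \<in> cells (Suc n)" "bd u c \<noteq> 0"
  shows "c \<in> cells n"
proof -
  obtain \<beta> T where c: "c = (\<beta>, T)" by (cases c)
  obtain q where "q \<in> J - T"
    "position_sign q T * (if q \<in> \<beta> then 1 else - 1) * u (insert q \<beta>, insert q T) \<noteq> 0"
    using assms(2) unfolding bd_def c by (auto elim: sum.not_neutral_contains_not_neutral)
  then have "u (insert q \<beta>, insert q T) \<noteq> 0" "q \<notin> T"
    by auto
  then show ?thesis
    using facet_in_cells assms(1) c by metis
qed

section \<open>Linearity of the boundary operator, its matrix and its square\<close>

lemma bd_add: "bd (\<lambda>c. u c + w c) y = bd u y + bd w y"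
  by (simp add: bd_def split_beta algebra_simps sum.distrib)

lemma bd_diff: "bd (\<lambda>c. u c - w c) y = bd u y - bd w y"
  by (simp add: bd_def split_beta algebra_simps sum_subtractf)

lemma bd_zero: "bd (\<lambda>c. 0) y = 0"
  by (simp add: bd_def split_beta)

lemma bd_eq_incidence:
  assumes "finite Z" "\<And>c. u c \<noteq> 0 \<Longrightarrow> c \<in> Z"
  shows "bd u y = (\<Sum>z\<in>Z. incidence y z * u z)"
proof -
  have u: "u c = (\<Sum>z\<in>Z. (if c = z then 1 else 0) * u z)" for c
    using assms(1) assms(2)[of c]
    by (cases "c \<in> Z") (simp_all add: if_distrib[of "\<lambda>x. x * _"] cong: if_cong, metis)
  obtain \<beta> T where y: "y = (\<beta>, T)" by (cases y)
  have "bd u y = (\<Sum>q \<in> J - T. \<Sum>z\<in>Z. position_sign q T * (if q \<in> \<beta> then 1 else - 1) *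
      ((if (insert q \<beta>, insert q T) = z then 1 else 0) * u z))"
    unfolding bd_def y by (subst u) (simp add: sum_distrib_left)
  also have "\<dots> = (\<Sum>z\<in>Z. \<Sum>q \<in> J - T. position_sign q T * (if q \<in> \<beta> then 1 else - 1) *
      ((if (insert q \<beta>, insert q T) = z then 1 else 0) * u z))"
    by (rule sum.swap)
  also have "\<dots> = (\<Sum>z\<in>Z. incidence y z * u z)"
    unfolding incidence_def bd_def y by (simp add: sum_distrib_right mult.assoc)
  finally show ?thesis .
qed

lemma incidence_nonzero:
  assumes "incidence (\<beta>, T) z \<noteq> (0 :: 'k::comm_ring_1)"
  shows "\<exists>q \<in> J - T. z = (insert q \<beta>, insert q T)"
proof (rule ccontr)
  assume "\<not> ?thesis"
  then have "incidence (\<beta>, T) z = (0 :: 'k)"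
    unfolding incidence_def bd_def by (auto intro!: sum.neutral)
  with assms show False by simp
qed

lemma position_sign_insert:
  assumes "finite T" "p \<notin> T" 
  shows "position_sign q (insert p T) = (if p < q then - position_sign q T else position_sign q T)"
proof -
  have "{s \<in> insert p T. s < q} = (if p < q then insert p {s \<in> T. s < q} else {s \<in> T. s < q})"
    by auto
  then show ?thesis
    using assms by (simp add: position_sign_def)
qed

text \<open>Pairs with \<open>q < p\<close> cancel against the swapped pairs. There is no division
  by two, so the argument covers characteristic 2.\<close>

lemma sum_antisymmetric:
  fixes F :: "nat \<Rightarrow> nat \<Rightarrow> 'k::ab_group_add"
  assumes "finite X" "\<And>p q. p \<in> X \<Longrightarrow> q \<in> X \<Longrightarrow> p \<noteq> q \<Longrightarrow> F p q = - F q p"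
  shows "(\<Sum>q\<in>X. \<Sum>p\<in>X - {q}. F q p) = 0"
proof -
  let ?L = "{(q, p). q \<in> X \<and> p \<in> X \<and> q < p}" and ?G = "{(q, p). q \<in> X \<and> p \<in> X \<and> p < q}"
  have fin: "finite ?L" "finite ?G"
    by (auto intro: finite_subset[OF _ finite_cartesian_product[OF assms(1) assms(1)]])
  have "(\<Sum>q\<in>X. \<Sum>p\<in>X - {q}. F q p) = (\<Sum>(q, p) \<in> (SIGMA q:X. X - {q}). F q p)"
    using assms(1) by (subst sum.Sigma) auto
  also have "(SIGMA q:X. X - {q}) = ?L \<union> ?G"
    by auto
  also have "(\<Sum>(q, p) \<in> ?L \<union> ?G. F q p) = (\<Sum>(q, p) \<in> ?L. F q p) + (\<Sum>(q, p) \<in> ?G. F q p)"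
    by (rule sum.union_disjoint) (use fin in auto)
  also have "(\<Sum>(q, p) \<in> ?G. F q p) = (\<Sum>(q, p) \<in> ?L. F p q)"
    by (rule sum.reindex_bij_witness[of _ prod.swap prod.swap]) auto
  also have "\<dots> = (\<Sum>(q, p) \<in> ?L. - F q p)"
    using assms(2) by (intro sum.cong) auto
  also have "\<dots> = - (\<Sum>(q, p) \<in> ?L. F q p)"
    by (subst sum_negf[symmetric]) (auto intro: sum.cong)
  finally show ?thesis
    by (simp only: add.right_inverse)
qed

text \<open>The directions \<open>q\<close> and \<open>p\<close> can be adjoined in either order and
  give the same cube. The factors telling upper from lower facets agree for both orders, since
  \<open>p \<noteq> q\<close>; the position signs are opposite, because the smaller direction shifts
  the position of the larger one.\<close>

lemma bd_bd:
  fixes u :: "nat set \<times> nat set \<Rightarrow> 'k::comm_ring_1"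
  assumes "finite T"
  shows "bd (bd u) (\<beta>, T) = 0"
proof -
  define \<epsilon> where "\<epsilon> q = (if q \<in> \<beta> then 1 else - 1 :: 'k)" for q
  define F where "F q p = position_sign q T * \<epsilon> q * (position_sign p (insert q T) * \<epsilon> p *
    u (insert p (insert q \<beta>), insert p (insert q T)))" for q p
  have "bd (bd u) (\<beta>, T) = (\<Sum>q \<in> J - T. \<Sum>p \<in> (J - T) - {q}. F q p)"
    unfolding bd_def F_def \<epsilon>_def
    by (auto simp: sum_distrib_left intro!: sum.cong)
  also have "\<dots> = 0"
  proof (rule sum_antisymmetric)
    fix p q assume pq: "p \<in> J - T" "q \<in> J - T" "p \<noteq> q"
    then have "position_sign q T * position_sign p (insert q T) =
        - (position_sign p T * position_sign q (insert p T) :: 'k)"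
      using assms by (auto simp: position_sign_insert)
    then have "F q p = - (position_sign p T * position_sign q (insert p T)) * (\<epsilon> q * \<epsilon> p *
        u (insert p (insert q \<beta>), insert p (insert q T)))"
      unfolding F_def by (metis (no_types, opaque_lifting) mult.assoc mult.left_commute)
    then show "F p q = - F q p"
      unfolding F_def by (simp add: insert_commute mult_ac)
  qed (use finite_J in auto)
  finally show ?thesis .
qed

lemma bd_bd_cell: "y \<in> cells n \<Longrightarrow> bd (bd u) y = 0"
  by (cases y) (metis bd_bd cellsD(5))

lemma sum_incidence_incidence:
  assumes "z \<in> cells (Suc (Suc n))" "x \<in> cells n"
  shows "(\<Sum>y \<in> cells (Suc n). incidence x y * incidence y z) = (0 :: 'k::comm_ring_1)"
proof -
  have *: "incidence y z \<noteq> (0 :: 'k) \<Longrightarrow> y \<in> cells (Suc n)" for y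
    unfolding incidence_def by (rule bd_supported[of "\<lambda>c. if c = z then 1 else 0"])
      (use assms(1) in \<open>auto split: if_splits\<close>)
  have "(\<Sum>y \<in> cells (Suc n). incidence x y * incidence y z) = bd (\<lambda>y. incidence y z :: 'k) x"
    by (rule bd_eq_incidence[symmetric, OF finite_cells *])
  also have "\<dots> = 0"
    unfolding incidence_def by (rule bd_bd_cell[OF assms(2)])
  finally show ?thesis .
qed

lemma incidence_vertex_edge:
  assumes "(\<alpha>, {q}) \<in> cells (Suc 0)"
  shows "incidence (\<beta>, {}) (\<alpha>, {q}) =
    (if \<beta> = \<alpha> then 1 else if \<beta> = \<alpha> - {q} then - 1 else 0 :: 'k::comm_ring_1)"
proof -
  have q: "q \<in> \<alpha>" "q \<in> J"
    using cellsD[OF assms] maxima_subset by auto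
  have "incidence (\<beta>, {}) (\<alpha>, {q}) = (\<Sum>p \<in> J. if p = q then
      (if p \<in> \<beta> then 1 else - 1) * (if insert p \<beta> = \<alpha> then 1 else 0) else 0 :: 'k)"
    unfolding incidence_def bd_def
    by (auto simp: position_sign_def intro!: sum.cong)
  also have "\<dots> = (if q \<in> \<beta> then 1 else - 1) * (if insert q \<beta> = \<alpha> then 1 else 0)"
    using finite_J q by simp
  also have "\<dots> = (if \<beta> = \<alpha> then 1 else if \<beta> = \<alpha> - {q} then - 1 else 0)"
    using q by auto
  finally show ?thesis .
qed

text \<open>An edge has exactly two end points, its top with coefficient 1 and its bottom with
  coefficient -1; hence augmentation after boundary is zero.\<close>

lemma sum_incidence_vertices:
  assumes "z \<in> cells (Suc 0)"
  shows "(\<Sum>y \<in> cells 0. incidence y z) = (0 :: 'k::comm_ring_1)"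
proof -
  obtain \<alpha> q where z: "z = (\<alpha>, {q})"
    using assms by (auto simp: cells_def card_1_singleton_iff)
  note c = cellsD[OF assms[unfolded z]]
  have q: "q \<in> \<alpha>"
    using c(2) maxima_subset by auto
  have v: "(\<alpha>, {}) \<in> cells 0" "(\<alpha> - {q}, {}) \<in> cells 0"
    using facet_in_cells[of q \<alpha> "{}" 0] facet_in_cells[of q "\<alpha> - {q}" "{}" 0] assms z q
    by (auto simp: insert_absorb)
  have ne: "(\<alpha>, {}) \<noteq> (\<alpha> - {q}, {})"
    using q by auto
  have i1: "incidence (\<alpha>, {}) z = (1 :: 'k)"
    by (simp add: z incidence_vertex_edge[OF assms[unfolded z]])
  have "\<alpha> - {q} \<noteq> \<alpha>"
    using q by auto
  then have i2: "incidence (\<alpha> - {q}, {}) z = (- 1 :: 'k)"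
    by (simp add: z incidence_vertex_edge[OF assms[unfolded z]])
  have "(\<Sum>y \<in> cells 0. incidence y z) = (\<Sum>y \<in> {(\<alpha>, {}), (\<alpha> - {q}, {})}. incidence y z :: 'k)"
  proof (rule sum.mono_neutral_right[OF finite_cells])
    show "\<forall>y \<in> cells 0 - {(\<alpha>, {}), (\<alpha> - {q}, {})}. incidence y z = (0 :: 'k)"
    proof
      fix y assume y: "y \<in> cells 0 - {(\<alpha>, {}), (\<alpha> - {q}, {})}"
      then obtain \<beta> where "y = (\<beta>, {})"
        using cellsD(3,5)[of "fst y" "snd y" 0] by (cases y) auto
      moreover from this have "\<beta> \<noteq> \<alpha>" "\<beta> \<noteq> \<alpha> - {q}"
        using y by auto
      ultimately show "incidence y z = (0 :: 'k)"
        by (simp add: z incidence_vertex_edge[OF assms[unfolded z]])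
    qed
  qed (use v in auto)
  also have "\<dots> = 0"
    using ne i1 i2 by simp
  finally show ?thesis .
qed

lemma sum_bd_vertices:
  assumes "\<And>c. u c \<noteq> 0 \<Longrightarrow> c \<in> cells (Suc 0)"
  shows "(\<Sum>y \<in> cells 0. bd u y) = (0 :: 'k::comm_ring_1)"
proof -
  have "(\<Sum>y \<in> cells 0. bd u y) = (\<Sum>y \<in> cells 0. \<Sum>z \<in> cells (Suc 0). incidence y z * u z)"
    by (intro sum.cong refl bd_eq_incidence finite_cells assms)
  also have "\<dots> = (\<Sum>z \<in> cells (Suc 0). (\<Sum>y \<in> cells 0. incidence y z) * u z)"
    by (subst sum.swap) (simp add: sum_distrib_right)
  finally show ?thesis
    by (simp add: sum_incidence_vertices)
qed

text \<open>Cycles for reduced homology: in degree 0 the augmentation replaces the boundary.\<close>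

definition cycle :: "nat \<Rightarrow> (nat set \<times> nat set \<Rightarrow> 'k::comm_ring_1) \<Rightarrow> bool" where
  "cycle n u \<longleftrightarrow> (case n of 0 \<Rightarrow> (\<Sum>c \<in> cells 0. u c) = 0 | Suc m \<Rightarrow> (\<forall>y \<in> cells m. bd u y = 0))"

text \<open>The cells whose degree divides a monomial with \<open>A\<close> (resp. \<open>B\<close>) the set of indices of the
  variables of the first (resp. second) kind that divide it.\<close>

definition cells_below :: "nat set \<Rightarrow> nat set \<Rightarrow> nat \<Rightarrow> (nat set \<times> nat set) set" where
  "cells_below A B n = {(\<alpha>, S) \<in> cells n. \<alpha> \<subseteq> A \<and> J - \<alpha> \<subseteq> B \<and> S \<subseteq> B}"

lemma cells_below_subset: "cells_below A B n \<subseteq> cells n"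
  by (auto simp: cells_below_def)

text \<open>These cells form a subcomplex. For a lower facet the complement of the top gains
  \<open>q\<close>, but \<open>q\<close> is a direction of the larger cube and hence already in
  \<open>B\<close>.\<close>

lemma bd_cells_below:
  assumes "\<And>c. u c \<noteq> 0 \<Longrightarrow> c \<in> cells_below A B (Suc n)" "bd u c \<noteq> 0"
  shows "c \<in> cells_below A B n"
proof -
  obtain \<beta> T where c: "c = (\<beta>, T)" by (cases c)
  obtain q where "q \<in> J - T"
    "position_sign q T * (if q \<in> \<beta> then 1 else - 1) * u (insert q \<beta>, insert q T) \<noteq> 0"
    using assms(2) unfolding bd_def c by (auto elim: sum.not_neutral_contains_not_neutral)
  then have "u (insert q \<beta>, insert q T) \<noteq> 0" "q \<notin> T"
    by auto
  then have "(insert q \<beta>, insert q T) \<in> cells_below A B (Suc n)" "q \<notin> T"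
    using assms(1) by auto
  then show ?thesis
    using facet_in_cells[of q \<beta> T n] by (auto simp: cells_below_def c)
qed

lemma cycle_diff_bd:
  assumes "cycle n u" "\<And>c. w c \<noteq> 0 \<Longrightarrow> c \<in> cells (Suc n)"
    and "\<And>c. u c \<noteq> 0 \<Longrightarrow> c \<in> cells n"
  shows "cycle n (\<lambda>c. u c - bd w c)"
proof (cases n)
  case 0
  then show ?thesis
    using assms sum_bd_vertices[of w] by (simp add: cycle_def sum_subtractf)
next
  case (Suc m)
  then show ?thesis
    using assms(1) by (simp add: cycle_def bd_diff bd_bd_cell)
qed

text \<open>Filter by the size of the top ideal. The part of fixed top \<open>\<alpha>\<close> is the augmented chain complex
  of the simplex on \<open>maxima \<alpha> \<inter> B\<close>, contracted by coning off its smallest vertex. If there is no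
  vertex then \<open>\<alpha>\<close> is the smallest ideal of \<open>cells_below A B 0\<close>.\<close>

theorem cycle_is_boundary:
  fixes u :: "nat set \<times> nat set \<Rightarrow> 'k::comm_ring_1"
  assumes "cycle n u" "\<And>c. u c \<noteq> 0 \<Longrightarrow> c \<in> cells_below A B n"
  shows "\<exists>w. (\<forall>c. w c \<noteq> 0 \<longrightarrow> c \<in> cells_below A B (Suc n)) \<and> bd w = u"
proof -
  have "\<exists>w. (\<forall>c. w c \<noteq> 0 \<longrightarrow> c \<in> cells_below A B (Suc n)) \<and> bd w = u"
    if "cycle n u" "\<And>c. u c \<noteq> 0 \<Longrightarrow> c \<in> cells_below A B n" "\<And>c. u c \<noteq> 0 \<Longrightarrow> card (fst c) < k"
    for k and u :: "nat set \<times> nat set \<Rightarrow> 'k"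
    using that
  proof (induction k arbitrary: u)
    case 0
    then have "u c = 0" for c
      using "0"(3)[of c] by auto
    then have "u = (\<lambda>c. 0)"
      by blast
    then show ?case
      by (intro exI[of _ "\<lambda>c. 0"]) (auto simp: bd_zero)
  next
    case (Suc k)
    define N where "N \<alpha> = maxima \<alpha> \<inter> B" for \<alpha>
    \<comment> \<open>The cone operator on the part of \<open>u\<close> whose tops have size
      \<open>k\<close>: a coefficient moves from a face without the apex to its join with the
      apex.\<close>
    define w where "w = (\<lambda>(\<alpha>, S). if card \<alpha> = k \<and> N \<alpha> \<noteq> {} \<and> Min (N \<alpha>) \<in> S
      then u (\<alpha>, S - {Min (N \<alpha>)}) else 0)"
    have u_cell: "\<alpha> \<in> ideals" "S \<subseteq> N \<alpha>" "card S = n" "finite S" "finite (N \<alpha>)" "J - B \<subseteq> \<alpha>"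
      "\<alpha> \<subseteq> J" "finite \<alpha>"
      if "u (\<alpha>, S) \<noteq> 0" for \<alpha> S
    proof -
      have c: "(\<alpha>, S) \<in> cells n" "\<alpha> \<subseteq> A" "J - \<alpha> \<subseteq> B" "S \<subseteq> B"
        using Suc.prems(2)[OF that] by (auto simp: cells_below_def)
      note d = cellsD[OF c(1)]
      show "\<alpha> \<in> ideals" "S \<subseteq> N \<alpha>" "card S = n" "finite S" "J - B \<subseteq> \<alpha>" "\<alpha> \<subseteq> J" "finite \<alpha>"
        using c d by (auto simp: N_def)
      show "finite (N \<alpha>)"
        using d(4) maxima_subset[of \<alpha>] by (auto simp: N_def intro: finite_subset)
    qed
    have w_below: "c \<in> cells_below A B (Suc n)" if "w c \<noteq> 0" for c
    proof -
      obtain \<alpha> S where c: "c = (\<alpha>, S)" by (cases c)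
      let ?q = "Min (N \<alpha>)"
      have *: "N \<alpha> \<noteq> {}" "?q \<in> S" "u (\<alpha>, S - {?q}) \<noteq> 0"
        using that by (auto simp: w_def c split: if_splits)
      note d = u_cell[OF *(3)]
      have q: "?q \<in> N \<alpha>"
        using *(1) d(5) by simp
      have "S \<subseteq> N \<alpha>"
        using d(2) q by blast
      moreover have "card S = Suc n"
        using card.remove[of S ?q] *(2) d(3,4) by simp
      moreover have "\<alpha> \<subseteq> A" "J - \<alpha> \<subseteq> B"
        using Suc.prems(2)[OF *(3)] by (auto simp: cells_below_def)
      ultimately show ?thesis
        using d(1) by (auto simp: c cells_below_def cells_def N_def)
    qed
    note w_cell = subsetD[OF cells_below_subset w_below]
      and u_in_cells = subsetD[OF cells_below_subset Suc.prems(2)]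
    \<comment> \<open>Subtracting \<open>bd w\<close> removes the part of \<open>u\<close> with tops
      of size \<open>k\<close>, and the induction hypothesis applies to the rest.\<close>
    have w_top: "bd w (\<alpha>, T) = u (\<alpha>, T)" if k: "k \<le> card \<alpha>" for \<alpha> T
    proof -
      \<comment> \<open>The enlarged top has more than \<open>k\<close> elements, where
        \<open>w\<close> vanishes. Only upper facets contribute to \<open>bd w\<close> here.\<close>
      have w_out: "w (insert q \<alpha>, S) = 0" if "q \<notin> \<alpha>" for q S
      proof (rule ccontr)
        assume w: "w (insert q \<alpha>, S) \<noteq> 0"
        have "finite (insert q \<alpha>)"
          by (rule cellsD(4)[OF w_cell[OF w]])
        then show False
          using w k that by (auto simp: w_def split: if_splits)
      qed
      have bd_w: "bd w (\<alpha>, T) = (\<Sum>q \<in> J - T. if q \<in> \<alpha> then position_sign q T * w (\<alpha>, insert q T) else 0)"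
        unfolding bd_def using w_out by (auto simp: insert_absorb intro!: sum.cong)
      consider "card \<alpha> > k" | "card \<alpha> = k" "\<alpha> \<notin> ideals" | "card \<alpha> = k" "N \<alpha> = {}"
        | "card \<alpha> = k" "\<alpha> \<in> ideals" "N \<alpha> \<noteq> {}"
        using k by linarith
      then show ?thesis
      proof cases
        case 1
        then have "w (\<alpha>, S) = 0" "u (\<alpha>, S) = 0" for S
          using Suc.prems(3)[of "(\<alpha>, S)"] by (auto simp: w_def)
        then show ?thesis
          by (simp add: bd_w cong: if_cong)
      next
        case 2
        then have "w (\<alpha>, S) = 0" "u (\<alpha>, S) = 0" for S
          using u_cell(1) by (auto simp: w_def)
        then show ?thesis
          by (simp add: bd_w cong: if_cong)
      next
        case 3
        \<comment> \<open>The maxima of \<alpha> lie outside \<open>B\<close>, and every ideal in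
          the support contains the elements outside \<open>B\<close>, hence contains \<alpha>. No
          top in the support is larger than \<alpha>, so a nonzero coefficient here would be the
          only one, against the vanishing coefficient sum.\<close>
        have "u (\<alpha>, T) = 0"
        proof (rule ccontr)
          assume u: "u (\<alpha>, T) \<noteq> 0"
          have T: "T = {}" and n: "n = 0"
            using u_cell(2,3)[OF u] 3 by auto
          have only: "c = (\<alpha>, T)" if "u c \<noteq> 0" for c
          proof -
            obtain \<beta> S where c: "c = (\<beta>, S)" by (cases c)
            note b = u_cell[OF that[unfolded c]]
            have "\<alpha> \<subseteq> \<beta>"
            proof
              fix a assume a: "a \<in> \<alpha>"
              obtain m where m: "m \<in> maxima \<alpha>" "le a m"
                using exists_maximum_above[OF u_cell(1)[OF u] a] by blast
              then have "m \<in> J - B"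
                using 3(2) u_cell(7)[OF u] maxima_subset[of \<alpha>] by (auto simp: N_def)
              then show "a \<in> \<beta>"
                using b(1,6) m(2) u_cell(7)[OF u] a unfolding ideals_def by blast
            qed
            moreover have "card \<beta> \<le> card \<alpha>"
              using Suc.prems(3)[OF that] 3(1) c by simp
            ultimately have "\<alpha> = \<beta>"
              using b(8) by (simp add: card_seteq)
            moreover have "S = {}"
              using b(3,4) n by simp
            ultimately show ?thesis
              using c T by simp
          qed
          have "(\<Sum>c \<in> cells 0. u c) = (\<Sum>c \<in> {(\<alpha>, T)}. u c)"
            using only u_in_cells[OF u] n
            by (intro sum.mono_neutral_right finite_cells) auto
          then show False
            using u Suc.prems(1) n by (simp add: cycle_def)
        qed
        moreover have "w (\<alpha>, S) = 0" for S
          using 3 by (simp add: w_def)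
        ultimately show ?thesis
          by (simp add: bd_w cong: if_cong)
      next
        case 4
        define q0 where "q0 = Min (N \<alpha>)"
        have N: "finite (N \<alpha>)" "N \<alpha> \<subseteq> \<alpha>" "\<alpha> \<subseteq> J"
          using idealsD[OF 4(2)] maxima_subset[of \<alpha>] by (auto simp: N_def intro: finite_subset)
        have q0: "q0 \<in> N \<alpha>" "q0 \<in> \<alpha>" "q0 \<in> J" and q0_min: "\<And>q. q \<in> N \<alpha> \<Longrightarrow> q0 \<le> q"
          unfolding q0_def using N Min_in[OF N(1) 4(3)] by auto
        \<comment> \<open>The apex precedes every other vertex, so joining it costs no sign.\<close>
        have sign_q0: "position_sign q0 (S - {q0}) * u (\<alpha>, S) = u (\<alpha>, S)" for S
        proof (cases "u (\<alpha>, S) = 0")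
          case False
          then have "{s \<in> S - {q0}. s < q0} = {}"
            using u_cell(2)[of \<alpha> S] q0_min by force
          then show ?thesis
            unfolding position_sign_def by (simp only: card.empty power_0 mult_1_left)
        qed simp
        have w_eq: "w (\<alpha>, S) = (if q0 \<in> S then u (\<alpha>, S - {q0}) else 0)" for S
          using 4 by (simp add: w_def q0_def)
        show ?thesis
        proof (cases "q0 \<in> T")
          case False
          \<comment> \<open>For \<open>T\<close> without the apex, only the direction
            \<open>q0\<close> produces a face on which \<open>w\<close> can be nonzero.\<close>
          have "bd w (\<alpha>, T) = (\<Sum>q \<in> J - T. if q = q0 then u (\<alpha>, T) else 0)"
            unfolding bd_w
          proof (rule sum.cong[OF refl])
            fix q assume "q \<in> J - T"
            show "(if q \<in> \<alpha> then position_sign q T * w (\<alpha>, insert q T) else 0) =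
                (if q = q0 then u (\<alpha>, T) else 0)"
              using sign_q0[of T] False q0(2) by (auto simp: w_eq)
          qed
          then show ?thesis
            using q0 False finite_J by simp
        next
          case True
          show ?thesis
          proof (cases n)
            case 0
            then have "u (\<alpha>, S) = 0" if "S \<noteq> {}" for S
              using u_cell(3,4)[of \<alpha> S] that by auto
            moreover have "insert q T - {q0} \<noteq> {}" if "q \<in> J - T" for q
              using that True by auto
            ultimately have "bd w (\<alpha>, T) = 0" "u (\<alpha>, T) = 0"
              using True by (auto simp: bd_w w_eq intro!: sum.neutral)
            then show ?thesis
              by simp
          next
            case (Suc m)
            \<comment> \<open>The cycle condition at the face opposite the apex isolates
              \<open>u (\<alpha>, T)\<close>. In the remaining terms a direction outside \<alpha>
              would give a top larger than \<open>k\<close>, and for the others moving past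
              \<open>q0\<close> changes the sign; their sum is
              \<open>- bd w (\<alpha>, T)\<close>.\<close>
            have "bd u (\<alpha>, T - {q0}) = 0"
            proof (rule ccontr)
              assume b: "bd u (\<alpha>, T - {q0}) \<noteq> 0"
              have "(\<alpha>, T - {q0}) \<in> cells m"
                by (rule bd_supported[OF u_in_cells[unfolded Suc] b])
              then show False
                using b Suc.prems(1) Suc by (simp add: cycle_def)
            qed
            moreover have "J - (T - {q0}) = insert q0 (J - T)"
              using q0(3) True by auto
            ultimately have "0 = position_sign q0 (T - {q0}) * u (\<alpha>, T) +
                (\<Sum>q \<in> J - T. position_sign q (T - {q0}) * (if q \<in> \<alpha> then 1 else - 1) *
                  u (insert q \<alpha>, insert q (T - {q0})))"
              using True finite_J q0(2) by (simp add: bd_def insert_absorb)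
            also have "(\<Sum>q \<in> J - T. position_sign q (T - {q0}) * (if q \<in> \<alpha> then 1 else - 1) *
                u (insert q \<alpha>, insert q (T - {q0}))) = (\<Sum>q \<in> J - T. - (if q \<in> \<alpha> then
                position_sign q T * w (\<alpha>, insert q T) else 0))"
            proof (rule sum.cong[OF refl])
              fix q assume q: "q \<in> J - T"
              then have ne: "q \<noteq> q0"
                using True by auto
              show "position_sign q (T - {q0}) * (if q \<in> \<alpha> then 1 else - 1) *
                  u (insert q \<alpha>, insert q (T - {q0})) =
                  - (if q \<in> \<alpha> then position_sign q T * w (\<alpha>, insert q T) else 0)"
              proof (cases "q \<in> \<alpha>")
                case False
                have "u (insert q \<alpha>, S) = 0" for S
                  using Suc.prems(3)[of "(insert q \<alpha>, S)"] False 4(1) idealsD(2)[OF 4(2)] by force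
                then show ?thesis
                  using False by simp
              next
                case qa: True
                have wq: "w (\<alpha>, insert q T) = u (\<alpha>, insert q (T - {q0}))"
                  using True ne by (simp add: w_eq insert_Diff_if)
                show ?thesis
                proof (cases "u (\<alpha>, insert q (T - {q0})) = 0")
                  case True
                  then show ?thesis
                    using wq qa by (simp add: insert_absorb)
                next
                  case False
                  have "q \<in> N \<alpha>" "finite (T - {q0})"
                    using u_cell(2,4)[OF False] by auto
                  then have "position_sign q (insert q0 (T - {q0})) = (- position_sign q (T - {q0}) :: 'k)"
                    using ne q0_min[of q] by (subst position_sign_insert) auto
                  then have "position_sign q T = (- position_sign q (T - {q0}) :: 'k)"
                    using True by (simp add: insert_absorb)
                  then show ?thesis
                    using wq qa by (simp add: insert_absorb)
                qed
              qed
            qed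
            also have "\<dots> = - bd w (\<alpha>, T)"
              unfolding bd_w by (rule sum_negf)
            finally show ?thesis
              unfolding sign_q0 by simp
          qed
        qed
      qed
    qed
    define u' where "u' c = u c - bd w c" for c
    have "\<exists>w'. (\<forall>c. w' c \<noteq> 0 \<longrightarrow> c \<in> cells_below A B (Suc n)) \<and> bd w' = u'"
    proof (rule Suc.IH)
      show "cycle n u'"
        unfolding u'_def by (rule cycle_diff_bd[OF Suc.prems(1) w_cell u_in_cells])
      fix c assume c: "u' c \<noteq> 0"
      then have "u c \<noteq> bd w c"
        by (simp add: u'_def)
      then consider "u c \<noteq> 0" | "bd w c \<noteq> 0"
        by force
      then show "c \<in> cells_below A B n"
      proof cases
        case 1
        then show ?thesis
          by (rule Suc.prems(2))
      next
        case 2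
        show ?thesis
          by (rule bd_cells_below[OF _ 2]) (rule w_below)
      qed
      show "card (fst c) < k"
        using w_top[of "fst c" "snd c"] c by (cases "k \<le> card (fst c)") (auto simp: u'_def)
    qed
    then obtain w' where w': "\<And>c. w' c \<noteq> 0 \<Longrightarrow> c \<in> cells_below A B (Suc n)" "bd w' = u'"
      by blast
    have "bd (\<lambda>c. w c + w' c) = u"
      using w'(2) by (auto simp: bd_add u'_def fun_eq_iff)
    moreover have "c \<in> cells_below A B (Suc n)" if "w c + w' c \<noteq> 0" for c
      using that w_below[of c] w'(1)[of c] by (cases "w c = 0") auto
    ultimately show ?case
      by (intro exI[of _ "\<lambda>c. w c + w' c"]) blast
  qed
  \<comment> \<open>Tops are subsets of \<open>J\<close>, so this bound on their size is met by
    every chain on the cells.\<close>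
  moreover have "card (fst c) < Suc (card J)" if "u c \<noteq> 0" for c
  proof -
    have "(fst c, snd c) \<in> cells n"
      using assms(2)[OF that] cells_below_subset by auto
    from card_mono[OF finite_J cellsD(7)[OF this]] show ?thesis
      by (simp add: less_Suc_eq_le)
  qed
  ultimately show ?thesis
    using assms by blast
qed

end

section \<open>The resolution of the cover ideal\<close>

definition squarefree_exponent :: "'v set \<Rightarrow> 'v \<Rightarrow>\<^sub>0 nat" where
  "squarefree_exponent W = (\<Sum>x\<in>W. Poly_Mapping.single x 1)"

lemma lookup_squarefree_exponent:
  "finite W \<Longrightarrow> Poly_Mapping.lookup (squarefree_exponent W) x = (if x \<in> W then 1 else 0)"
  by (simp add: squarefree_exponent_def lookup_sum lookup_single when_def)

lemma keys_squarefree_exponent: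
  "finite W \<Longrightarrow> Poly_Mapping.keys (squarefree_exponent W) = W"
  by (auto simp: in_keys_iff lookup_squarefree_exponent split: if_splits)

lemma exponent_le_squarefree:
  "finite W \<Longrightarrow> exponent_le (squarefree_exponent W) M \<longleftrightarrow> W \<subseteq> Poly_Mapping.keys M"
  by (auto simp: exponent_le_def lookup_squarefree_exponent in_keys_iff Suc_le_eq subset_iff)

lemma prod_var:
  "finite W \<Longrightarrow> (\<Prod>x\<in>W. var x) = (Poly_Mapping.single (squarefree_exponent W) 1 :: ('v, 'k::field) mpoly)"
  by (induction W rule: finite_induct) (simp_all add: var_def mult_single squarefree_exponent_def)

lemma cring_poly_ring: "cring (poly_ring V :: ('v, 'k::field) mpoly ring)"
proof (rule cringI)
  show "abelian_group (poly_ring V :: ('v, 'k) mpoly ring)"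
  proof (rule abelian_groupI)
    fix f :: "('v, 'k) mpoly" assume "f \<in> carrier (poly_ring V)"
    then show "\<exists>g \<in> carrier (poly_ring V). g \<oplus>\<^bsub>poly_ring V\<^esub> f = \<zero>\<^bsub>poly_ring V\<^esub>"
      by (intro bexI[of _ "- f"]) (simp_all add: poly_ring_simps poly_ring_uminus)
  qed (auto simp: poly_ring_simps poly_ring_add poly_ring_zero ac_simps)
  show "Group.comm_monoid (poly_ring V :: ('v, 'k) mpoly ring)"
    by (rule comm_monoidI) (auto simp: poly_ring_simps poly_ring_mult poly_ring_one ac_simps)
qed (auto simp: poly_ring_simps algebra_simps)

text \<open>The graph seen through a given isomorphism: \<open>x1 j\<close> and \<open>x2 j\<close>
  are the vertices of \<open>V\<close> that carry the two kinds of variables.\<close>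

locale cp2_graph = labelled_poset J le for J :: "nat set" and le +
  fixes x1 x2 :: "nat \<Rightarrow> 'v" and V :: "'v set" and E :: "'v set set"
  assumes inj_x1: "inj_on x1 J" and inj_x2: "inj_on x2 J" and x1_x2: "x1 ` J \<inter> x2 ` J = {}"
    and V_eq: "V = x1 ` J \<union> x2 ` J"
    and E_eq: "E = {{x1 a, x2 b} | a b. a \<in> J \<and> b \<in> J \<and> le a b}"
begin

text \<open>An ideal \<beta> yields the cover with first variables at \<beta> and second variables
  at its complement. The set here is the union of these covers over the vertices of the cube, that
  is, the support of their least common multiple.\<close>

definition cell_cover :: "nat set \<times> nat set \<Rightarrow> 'v set" where
  "cell_cover = (\<lambda>(\<alpha>, S). x1 ` \<alpha> \<union> x2 ` ((J - \<alpha>) \<union> S))"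

definition cell_degree :: "nat set \<times> nat set \<Rightarrow> 'v \<Rightarrow>\<^sub>0 nat" where
  "cell_degree c = squarefree_exponent (cell_cover c)"

lemma cell_cover_subset:
  assumes "c \<in> cells n"
  shows "cell_cover c \<subseteq> V" "finite (cell_cover c)"
proof -
  show "cell_cover c \<subseteq> V"
    using assms cellsD(6,7) by (cases c) (fastforce simp: cell_cover_def V_eq)
  then show "finite (cell_cover c)"
    by (rule finite_subset) (simp add: V_eq finite_J)
qed

lemma keys_cell_degree_subset:
  "c \<in> cells n \<Longrightarrow> Poly_Mapping.keys (cell_degree c) \<subseteq> V"
  by (simp add: cell_degree_def keys_squarefree_exponent cell_cover_subset)

lemma keys_cell_degree: "c \<in> cells n \<Longrightarrow> Poly_Mapping.keys (cell_degree c) = cell_cover c"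
  by (simp add: cell_degree_def keys_squarefree_exponent cell_cover_subset)

text \<open>Labels are squarefree, so only the support of \<open>M\<close> matters, and it splits
  into the variables of the two kinds.\<close>

lemma exponent_le_cell_degree:
  assumes "c \<in> cells n"
  shows "exponent_le (cell_degree c) M \<longleftrightarrow>
    c \<in> cells_below {j \<in> J. x1 j \<in> Poly_Mapping.keys M} {j \<in> J. x2 j \<in> Poly_Mapping.keys M} n"
proof -
  obtain \<alpha> S where c: "c = (\<alpha>, S)" by (cases c)
  have "\<alpha> \<subseteq> J" "S \<subseteq> J"
    using cellsD(6,7) assms c by auto
  then show ?thesis
    using assms cell_cover_subset(2)[OF assms]
    by (auto simp: cell_degree_def exponent_le_squarefree c cells_below_def cell_cover_def)
qed

text \<open>In direction \<open>q\<close> the upper facet loses \<open>x2 q\<close> and the lower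
  facet loses \<open>x1 q\<close>.\<close>

lemma incidence_cell_cover:
  assumes "y \<in> cells n" "incidence y z \<noteq> (0 :: 'k::comm_ring_1)"
  shows "cell_cover y \<subset> cell_cover z"
proof -
  obtain \<beta> T where y: "y = (\<beta>, T)" by (cases y)
  obtain q where q: "q \<in> J" "q \<notin> T" and z: "z = (insert q \<beta>, insert q T)"
    using incidence_nonzero assms(2) y by (metis DiffE)
  have b: "\<beta> \<subseteq> J" "T \<subseteq> J"
    using cellsD(6,7) assms(1) y by auto
  have sub: "cell_cover y \<subseteq> cell_cover z"
    by (auto simp: cell_cover_def y z)
  show ?thesis
  proof (cases "q \<in> \<beta>")
    case True
    have "x2 q \<notin> x1 ` \<beta>"
      using x1_x2 b q by blast
    moreover have "x2 q \<notin> x2 ` ((J - \<beta>) \<union> T)"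
      using inj_onD[OF inj_x2] b q True by blast
    ultimately have "x2 q \<notin> cell_cover y"
      by (simp add: cell_cover_def y)
    moreover have "x2 q \<in> cell_cover z"
      by (simp add: cell_cover_def z)
    ultimately show ?thesis
      using sub by blast
  next
    case False
    have "x1 q \<notin> x2 ` ((J - \<beta>) \<union> T)"
      using x1_x2 b q by blast
    moreover have "x1 q \<notin> x1 ` \<beta>"
      using inj_onD[OF inj_x1] b q False by blast
    ultimately have "x1 q \<notin> cell_cover y"
      by (simp add: cell_cover_def y)
    moreover have "x1 q \<in> cell_cover z"
      by (simp add: cell_cover_def z)
    ultimately show ?thesis
      using sub by blast
  qed
qed

text \<open>The second claim is minimality: every nonzero entry of a differential is a scalar times
  a nonconstant monomial.\<close>

lemma incidence_cell_degree:
  assumes "y \<in> cells n" "z \<in> cells m" "incidence y z \<noteq> (0 :: 'k::comm_ring_1)"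
  shows "exponent_le (cell_degree y) (cell_degree z)" "cell_degree z - cell_degree y \<noteq> 0"
proof -
  have sub: "cell_cover y \<subset> cell_cover z"
    by (rule incidence_cell_cover[OF assms(1,3)])
  then show le: "exponent_le (cell_degree y) (cell_degree z)"
    using cell_cover_subset(2)[OF assms(1)] cell_cover_subset(2)[OF assms(2)]
    by (auto simp: cell_degree_def exponent_le_squarefree keys_squarefree_exponent)
  show "cell_degree z - cell_degree y \<noteq> 0"
  proof
    assume "cell_degree z - cell_degree y = 0"
    then have "cell_degree z = cell_degree y"
      using exponent_le_add_diff[OF le] by simp
    then show False
      using keys_cell_degree[OF assms(1)] keys_cell_degree[OF assms(2)] sub by auto
  qed
qed

definition cell_list :: "nat \<Rightarrow> (nat set \<times> nat set) list" where
  "cell_list n = (SOME cs. set cs = cells n \<and> distinct cs)"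

lemma cell_list: "set (cell_list n) = cells n" "distinct (cell_list n)"
  using someI_ex[OF finite_distinct_list[OF finite_cells[of n]]] by (simp_all add: cell_list_def)

text \<open>The augmentation is also a homogenized matrix: its single row is labelled by the
  exponent 0 and has all scalars 1, so its entries are the monomials of the covers attached to
  ideals.\<close>

fun cube_resolution :: "nat \<Rightarrow> ('v, 'k::field) mpoly mat" where
  "cube_resolution 0 = homogenized_mat [()] (cell_list 0) (\<lambda>_. 0) cell_degree (\<lambda>_ _. 1)"
| "cube_resolution (Suc n) =
    homogenized_mat (cell_list n) (cell_list (Suc n)) cell_degree cell_degree incidence"

lemma dim_col_cube_resolution: "dim_col (cube_resolution n) = length (cell_list n)"
  by (cases n) simp_all

lemma residue_cube_resolution:
  "residue_mat (cube_resolution (Suc n) :: ('v, 'k::field) mpoly mat) =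
    0\<^sub>m (dim_col (cube_resolution n :: ('v, 'k) mpoly mat))
      (dim_col (cube_resolution (Suc n) :: ('v, 'k) mpoly mat))"
proof (rule eq_matI)
  fix i j assume "i < dim_row (0\<^sub>m (dim_col (cube_resolution n :: ('v, 'k) mpoly mat))
      (dim_col (cube_resolution (Suc n) :: ('v, 'k) mpoly mat)) :: 'k mat)"
    "j < dim_col (0\<^sub>m (dim_col (cube_resolution n :: ('v, 'k) mpoly mat))
      (dim_col (cube_resolution (Suc n) :: ('v, 'k) mpoly mat)) :: 'k mat)"
  then have ij: "i < length (cell_list n)" "j < length (cell_list (Suc n))"
    by (simp_all add: dim_col_cube_resolution)
  then have "cell_list n ! i \<in> cells n" "cell_list (Suc n) ! j \<in> cells (Suc n)"
    using cell_list(1) nth_mem by blast+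
  then have "incidence (cell_list n ! i) (cell_list (Suc n) ! j) = (0 :: 'k) \<or>
      cell_degree (cell_list (Suc n) ! j) - cell_degree (cell_list n ! i) \<noteq> 0"
    using incidence_cell_degree(2) by blast
  then show "residue_mat (cube_resolution (Suc n)) $$ (i, j) =
      (0\<^sub>m (dim_col (cube_resolution n :: ('v, 'k) mpoly mat))
        (dim_col (cube_resolution (Suc n) :: ('v, 'k) mpoly mat)) :: 'k mat) $$ (i, j)"
    using ij by (auto simp: residue_mat_def homogenized_mat_def lookup_single dim_col_cube_resolution)
qed (simp_all add: dim_col_cube_resolution)

lemma cells_exact:
  fixes u :: "nat set \<times> nat set \<Rightarrow> 'k::field"
  assumes u: "\<And>y. u y \<noteq> 0 \<Longrightarrow> y \<in> cells n \<and> exponent_le (cell_degree y) M" and "cycle n u"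
  shows "\<exists>w. (\<forall>z. w z \<noteq> 0 \<longrightarrow> z \<in> cells (Suc n) \<and> exponent_le (cell_degree z) M) \<and>
    (\<forall>y \<in> cells n. u y = (\<Sum>z \<in> cells (Suc n). incidence y z * w z))"
proof -
  let ?B = "cells_below {j \<in> J. x1 j \<in> Poly_Mapping.keys M} {j \<in> J. x2 j \<in> Poly_Mapping.keys M}"
  have "y \<in> ?B n" if "u y \<noteq> 0" for y
    using u[OF that] exponent_le_cell_degree by blast
  then obtain w where w: "\<And>c. w c \<noteq> 0 \<Longrightarrow> c \<in> ?B (Suc n)" "bd w = u"
    using cycle_is_boundary[OF assms(2), of "{j \<in> J. x1 j \<in> Poly_Mapping.keys M}"
        "{j \<in> J. x2 j \<in> Poly_Mapping.keys M}"] by blast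
  have cell: "z \<in> cells (Suc n)" if "w z \<noteq> 0" for z
    using w(1)[OF that] cells_below_subset by blast
  have "u y = (\<Sum>z \<in> cells (Suc n). incidence y z * w z)" for y
    unfolding w(2)[symmetric] by (rule bd_eq_incidence[OF finite_cells cell])
  moreover have "exponent_le (cell_degree z) M" if "w z \<noteq> 0" for z
    using w(1)[OF that] exponent_le_cell_degree[OF cell[OF that]] by simp
  ultimately show ?thesis
    using cell by blast
qed

lemma cube_resolution_exact:
  "{v \<in> poly_vec V (length (cell_list n)).
      (cube_resolution n :: ('v, 'k) mpoly mat) *\<^sub>v v = 0\<^sub>v (dim_row (cube_resolution n :: ('v, 'k::field) mpoly mat))} =
    {cube_resolution (Suc n) *\<^sub>v w | w. w \<in> poly_vec V (length (cell_list (Suc n)))}"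
proof (cases n)
  case 0
  have "{v \<in> poly_vec V (length (cell_list 0)).
      homogenized_mat [()] (cell_list 0) (\<lambda>_. 0) cell_degree (\<lambda>_ _. 1 :: 'k) *\<^sub>v v = 0\<^sub>v (length [()])} =
    {homogenized_mat (cell_list 0) (cell_list (Suc 0)) cell_degree cell_degree incidence *\<^sub>v w | w.
      w \<in> poly_vec V (length (cell_list (Suc 0)))}"
  proof (rule homogenized_mat_exact[OF cell_list(2) cell_list(2)], unfold cell_list(1))
    show "\<exists>w. (\<forall>z. w z \<noteq> 0 \<longrightarrow> z \<in> cells (Suc 0) \<and> exponent_le (cell_degree z) M) \<and>
        (\<forall>y \<in> cells 0. u y = (\<Sum>z \<in> cells (Suc 0). incidence y z * w z))"
      if "\<And>y. u y \<noteq> 0 \<Longrightarrow> y \<in> cells 0 \<and> exponent_le (cell_degree y) M"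
        "\<And>x. x \<in> set [()] \<Longrightarrow> (\<Sum>y \<in> cells 0. 1 * u y) = 0" for M and u :: "_ \<Rightarrow> 'k"
      using cells_exact[OF that(1)] that(2) by (simp add: cycle_def)
    show "exponent_le (cell_degree y) (cell_degree z)"
      if "y \<in> cells 0" "z \<in> cells (Suc 0)" "incidence y z \<noteq> (0 :: 'k)" for y z
      using that by (rule incidence_cell_degree(1))
    show "(\<Sum>y \<in> cells 0. 1 * incidence y z) = (0 :: 'k)" if "z \<in> cells (Suc 0)" for z
      using sum_incidence_vertices[OF that] by simp
  qed (simp add: exponent_le_def, (erule keys_cell_degree_subset)+)
  then show ?thesis
    by (simp add: 0)
next
  case (Suc m)
  have "{v \<in> poly_vec V (length (cell_list (Suc m))).
      homogenized_mat (cell_list m) (cell_list (Suc m)) cell_degree cell_degree (incidence :: _ \<Rightarrow> _ \<Rightarrow> 'k) *\<^sub>v v =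
        0\<^sub>v (length (cell_list m))} =
    {homogenized_mat (cell_list (Suc m)) (cell_list (Suc (Suc m))) cell_degree cell_degree incidence *\<^sub>v w | w.
      w \<in> poly_vec V (length (cell_list (Suc (Suc m))))}"
  proof (rule homogenized_mat_exact[OF cell_list(2) cell_list(2)], unfold cell_list(1))
    show "\<exists>w. (\<forall>z. w z \<noteq> 0 \<longrightarrow> z \<in> cells (Suc (Suc m)) \<and> exponent_le (cell_degree z) M) \<and>
        (\<forall>y \<in> cells (Suc m). u y = (\<Sum>z \<in> cells (Suc (Suc m)). incidence y z * w z))"
      if u: "\<And>y. u y \<noteq> 0 \<Longrightarrow> y \<in> cells (Suc m) \<and> exponent_le (cell_degree y) M"
        and c: "\<And>x. x \<in> cells m \<Longrightarrow> (\<Sum>y \<in> cells (Suc m). incidence x y * u y) = 0"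
      for M and u :: "_ \<Rightarrow> 'k"
    proof (rule cells_exact[OF u])
      \<comment> \<open>Expanding \<open>bd\<close> over the cells that support \<open>u\<close>
        turns the kernel condition on the matrix into the cycle condition.\<close>
      have "bd u y = (\<Sum>z \<in> cells (Suc m). incidence y z * u z)" for y
        using u by (intro bd_eq_incidence finite_cells) blast
      then show "cycle (Suc m) u"
        using c by (simp add: cycle_def)
    qed
  qed ((rule incidence_cell_degree(1) sum_incidence_incidence keys_cell_degree_subset; assumption)+)
  then show ?thesis
    by (simp add: Suc)
qed

text \<open>An edge joins \<open>x1 a\<close> to \<open>x2 b\<close> with \<open>a\<close> below
  \<open>b\<close>. If \<open>b\<close> is in the ideal then so is \<open>a\<close>; otherwise
  \<open>x2 b\<close> is in the cover.\<close>

lemma cell_cover_vertex_cover: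
  assumes "c \<in> cells 0"
  shows "vertex_cover V E (cell_cover c)"
proof -
  obtain \<alpha> S where c: "c = (\<alpha>, S)" by (cases c)
  have "e \<inter> cell_cover c \<noteq> {}" if e: "e \<in> E" for e
  proof -
    obtain a b where ab: "e = {x1 a, x2 b}" "a \<in> J" "b \<in> J" "le a b"
      using e unfolding E_eq by blast
    show ?thesis
    proof (cases "b \<in> \<alpha>")
      case True
      then have "a \<in> \<alpha>"
        using cellsD(1) assms ab(2,4) unfolding c ideals_def by blast
      then show ?thesis
        by (auto simp: ab cell_cover_def c)
    next
      case False
      then show ?thesis
        using ab(3) by (auto simp: ab cell_cover_def c)
    qed
  qed
  then show ?thesis
    using cell_cover_subset(1)[OF assms] by (simp add: vertex_cover_def)
qed

text \<open>If \<open>x2 b\<close> is missing from \<open>W\<close>, the edges at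
  \<open>x2 b\<close> force \<open>x1 a\<close> into \<open>W\<close> for all \<open>a\<close> below
  \<open>b\<close>. The elements forced in this way form an ideal, and by reflexivity
  \<open>W\<close> contains \<open>x2 b\<close> for every \<open>b\<close> outside it.\<close>

lemma vertex_cover_above_cell:
  assumes "vertex_cover V E W"
  shows "\<exists>c \<in> cells 0. cell_cover c \<subseteq> W"
proof -
  define \<alpha> where "\<alpha> = {a \<in> J. \<exists>b \<in> J. le a b \<and> x2 b \<notin> W}"
  have "\<alpha> \<in> ideals"
    using le_trans unfolding ideals_def \<alpha>_def by blast
  then have "(\<alpha>, {}) \<in> cells 0"
    by (simp add: cells_def)
  moreover have "x1 a \<in> W" if a: "a \<in> \<alpha>" for a
  proof -
    obtain b where b: "a \<in> J" "b \<in> J" "le a b" "x2 b \<notin> W"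
      using a unfolding \<alpha>_def by blast
    then have "{x1 a, x2 b} \<in> E"
      unfolding E_eq by blast
    then have "{x1 a, x2 b} \<inter> W \<noteq> {}"
      using assms unfolding vertex_cover_def by blast
    then show ?thesis
      using b by blast
  qed
  moreover have "x2 b \<in> W" if "b \<in> J - \<alpha>" for b
    using that le_refl unfolding \<alpha>_def by blast
  ultimately show ?thesis
    by (intro bexI[of _ "(\<alpha>, {})"]) (auto simp: cell_cover_def)
qed

section \<open>The image of the augmentation and the cover ideal\<close>

lemma cube_resolution_augmentation:
  "(cube_resolution 0 *\<^sub>v vec (length (cell_list 0)) (\<lambda>j. f (cell_list 0 ! j))) $ 0 =
    (\<Sum>c \<in> cells 0. Poly_Mapping.single (cell_degree c) 1 * f c :: ('v, 'k::field) mpoly)"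
  using homogenized_mat_mult_vec[OF cell_list(2), where i = 0 and xs = "[()]" and
      degX = "\<lambda>_. 0" and degY = cell_degree and s = "\<lambda>_ _. 1" and f = f]
  by (simp add: cell_list(1))

lemma image_augmentation:
  "{(cube_resolution 0 *\<^sub>v v) $ 0 | v. v \<in> poly_vec V (length (cell_list 0))} =
    {\<Sum>c \<in> cells 0. Poly_Mapping.single (cell_degree c) 1 * f c | f.
      \<forall>c \<in> cells 0. f c \<in> (carrier (poly_ring V) :: ('v, 'k::field) mpoly set)}" (is "?L = ?R")
proof (intro equalityI subsetI)
  fix g assume "g \<in> ?L"
  then obtain v where v: "v \<in> poly_vec V (length (cell_list 0))" "g = (cube_resolution 0 *\<^sub>v v) $ 0"
    by blast
  then obtain f where f: "v = vec (length (cell_list 0)) (\<lambda>j. f (cell_list 0 ! j))"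
    using vec_of_cells[OF cell_list(2)] unfolding poly_vec_def by blast
  have "f c \<in> carrier (poly_ring V)" if "c \<in> cells 0" for c
    using v(1) that unfolding cell_list(1)[symmetric] by (auto simp: f poly_vec_def in_set_conv_nth)
  then show "g \<in> ?R"
    unfolding v(2) f cube_resolution_augmentation by blast
next
  fix g assume "g \<in> ?R"
  then obtain f where f: "g = (\<Sum>c \<in> cells 0. Poly_Mapping.single (cell_degree c) 1 * f c)"
    "\<And>c. c \<in> cells 0 \<Longrightarrow> f c \<in> carrier (poly_ring V)"
    by blast
  have "vec (length (cell_list 0)) (\<lambda>j. f (cell_list 0 ! j)) \<in> poly_vec V (length (cell_list 0))"
    using f(2) nth_mem[of _ "cell_list 0"] by (auto simp: poly_vec_def cell_list(1))
  then show "g \<in> ?L"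
    unfolding f(1) cube_resolution_augmentation[symmetric] by blast
qed

text \<open>The cover of some ideal lies in each vertex cover, so these covers generate. The set of
  combinations on the right is the form in which the image of the augmentation appears.\<close>

lemma cover_ideal_eq:
  "cover_ideal V E = {\<Sum>c \<in> cells 0. Poly_Mapping.single (cell_degree c) 1 * f c | f.
    \<forall>c \<in> cells 0. f c \<in> (carrier (poly_ring V) :: ('v, 'k::field) mpoly set)}" (is "_ = ?R")
proof -
  let ?T = "poly_ring V :: ('v, 'k) mpoly ring"
  let ?S = "{\<Prod>x\<in>W. var x | W. vertex_cover V E W} :: ('v, 'k) mpoly set"
  interpret cring ?T
    by (rule cring_poly_ring)
  have finV: "finite V"
    using finite_J by (simp add: V_eq)
  have S: "Poly_Mapping.single (squarefree_exponent W) 1 \<in> ?S" if "vertex_cover V E W" for W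
    using that prod_var[of W, where 'k = 'k] finite_subset[OF _ finV]
    by (auto simp: vertex_cover_def intro!: exI[of _ W])
  have S_carrier: "?S \<subseteq> carrier ?T"
  proof
    fix g assume "g \<in> ?S"
    then obtain W where "g = (\<Prod>x\<in>W. var x)" "W \<subseteq> V"
      by (auto simp: vertex_cover_def)
    then show "g \<in> carrier ?T"
      using finite_subset[OF _ finV, of W]
      by (simp add: prod_var poly_ring_single keys_squarefree_exponent)
  qed
  have R_I: "(\<Sum>c \<in> cells 0. Poly_Mapping.single (cell_degree c) 1 * h c) \<in> ?R"
    if "\<And>c. c \<in> cells 0 \<Longrightarrow> h c \<in> carrier ?T" for h
    using that by blast
  have R_ideal: "ideal ?R ?T"
  proof (rule idealI[OF ring_axioms])
    have deg: "Poly_Mapping.single (cell_degree c) 1 \<in> carrier ?T" if "c \<in> cells 0" for c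
      using keys_cell_degree[OF that] cell_cover_subset(1)[OF that] by (simp add: poly_ring_single)
    show "subgroup ?R (add_monoid ?T)"
    proof (rule add.subgroupI)
      show "?R \<subseteq> carrier ?T"
        using deg by (auto intro!: poly_ring_sum poly_ring_mult)
      from R_I[of "\<lambda>_. 0"] show "?R \<noteq> {}"
        using poly_ring_zero by blast
      show "\<ominus>\<^bsub>?T\<^esub> g \<in> ?R" if g: "g \<in> ?R" for g
      proof -
        obtain f where f: "g = (\<Sum>c \<in> cells 0. Poly_Mapping.single (cell_degree c) 1 * f c)"
          "\<forall>c \<in> cells 0. f c \<in> carrier ?T"
          using g by blast
        have "g \<in> carrier ?T"
          using deg f by (auto intro!: poly_ring_sum poly_ring_mult)
        then have "\<ominus>\<^bsub>?T\<^esub> g = - g"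
          using minus_equality[of "- g" g] by (simp add: poly_ring_simps poly_ring_uminus)
        also have "\<dots> = (\<Sum>c \<in> cells 0. Poly_Mapping.single (cell_degree c) 1 * (- f c))"
          by (simp add: f(1) sum_negf)
        finally show ?thesis
          using R_I[of "\<lambda>c. - f c"] f(2) by (simp add: poly_ring_uminus)
      qed
      show "g \<oplus>\<^bsub>?T\<^esub> h \<in> ?R" if g: "g \<in> ?R" and h: "h \<in> ?R" for g h
      proof -
        obtain f where f: "g = (\<Sum>c \<in> cells 0. Poly_Mapping.single (cell_degree c) 1 * f c)"
          "\<forall>c \<in> cells 0. f c \<in> carrier ?T"
          using g by blast
        obtain f' where f': "h = (\<Sum>c \<in> cells 0. Poly_Mapping.single (cell_degree c) 1 * f' c)"
          "\<forall>c \<in> cells 0. f' c \<in> carrier ?T"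
          using h by blast
        have "g \<oplus>\<^bsub>?T\<^esub> h = (\<Sum>c \<in> cells 0. Poly_Mapping.single (cell_degree c) 1 * (f c + f' c))"
          by (simp add: f(1) f'(1) poly_ring_simps sum.distrib distrib_left)
        then show ?thesis
          using R_I[of "\<lambda>c. f c + f' c"] f(2) f'(2) by (simp add: poly_ring_add)
      qed
    qed
    show mult: "x \<otimes>\<^bsub>?T\<^esub> g \<in> ?R" if g: "g \<in> ?R" and x: "x \<in> carrier ?T" for g x
    proof -
      obtain f where f: "g = (\<Sum>c \<in> cells 0. Poly_Mapping.single (cell_degree c) 1 * f c)"
        "\<forall>c \<in> cells 0. f c \<in> carrier ?T"
        using g by blast
      have "x \<otimes>\<^bsub>?T\<^esub> g = (\<Sum>c \<in> cells 0. Poly_Mapping.single (cell_degree c) 1 * (x * f c))"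
        by (simp add: f(1) poly_ring_simps sum_distrib_left mult.left_commute)
      then show ?thesis
        using R_I[of "\<lambda>c. x * f c"] f(2) x by (simp add: poly_ring_mult)
    qed
    show "g \<otimes>\<^bsub>?T\<^esub> x \<in> ?R" if "g \<in> ?R" "x \<in> carrier ?T" for g x
      using mult[OF that] by (simp add: poly_ring_simps mult.commute)
  qed
  show ?thesis
    unfolding cover_ideal_def
  proof (intro equalityI)
    show "genideal ?T ?S \<subseteq> ?R"
    proof (rule genideal_minimal[OF R_ideal], rule subsetI)
      fix g assume "g \<in> ?S"
      then obtain W where W: "g = (\<Prod>x\<in>W. var x)" "vertex_cover V E W"
        by blast
      then have WV: "W \<subseteq> V" "finite W"
        using finite_subset[OF _ finV] by (auto simp: vertex_cover_def)
      obtain c where c: "c \<in> cells 0" "cell_cover c \<subseteq> W"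
        using vertex_cover_above_cell[OF W(2)] by blast
      \<comment> \<open>The generator of \<open>W\<close> is the monomial of \<open>c\<close> times
        this quotient monomial; all other coefficients are zero.\<close>
      define f :: "_ \<Rightarrow> ('v, 'k) mpoly" where
        "f b = (if b = c then Poly_Mapping.single (squarefree_exponent W - cell_degree c) 1 else 0)" for b
      have le: "exponent_le (cell_degree c) (squarefree_exponent W)"
        using c(2) cell_cover_subset(2)[OF c(1)] WV(2)
        by (simp add: cell_degree_def exponent_le_squarefree keys_squarefree_exponent)
      have "g = Poly_Mapping.single (cell_degree c) 1 * f c"
        by (simp add: W(1) prod_var WV(2) f_def mult_single exponent_le_add_diff[OF le])
      also have "\<dots> = (\<Sum>b \<in> cells 0. if b = c then Poly_Mapping.single (cell_degree c) 1 * f c else 0)"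
        using c(1) finite_cells by simp
      also have "\<dots> = (\<Sum>b \<in> cells 0. Poly_Mapping.single (cell_degree b) 1 * f b)"
        by (intro sum.cong) (auto simp: f_def)
      finally have "g = (\<Sum>b \<in> cells 0. Poly_Mapping.single (cell_degree b) 1 * f b)" .
      moreover have "f b \<in> carrier ?T" for b
        using order_trans[OF keys_diff_exponent, of "squarefree_exponent W" V] WV
        by (simp add: f_def poly_ring_zero poly_ring_single keys_squarefree_exponent)
      ultimately show "g \<in> ?R"
        using R_I by simp
    qed
    show "?R \<subseteq> genideal ?T ?S"
    proof
      fix g assume "g \<in> ?R"
      then obtain f where f: "g = (\<Sum>c \<in> cells 0. Poly_Mapping.single (cell_degree c) 1 * f c)"
        "\<forall>c \<in> cells 0. f c \<in> carrier ?T"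
        by blast
      interpret I: ideal "genideal ?T ?S" ?T
        by (rule genideal_ideal[OF S_carrier])
      have gen: "Poly_Mapping.single (cell_degree c) 1 * f c \<in> genideal ?T ?S" if c: "c \<in> cells 0" for c
      proof -
        have "Poly_Mapping.single (cell_degree c) 1 \<in> genideal ?T ?S"
          using S[OF cell_cover_vertex_cover[OF c]] genideal_self[OF S_carrier]
          unfolding cell_degree_def by blast
        from I.I_r_closed[OF this] show ?thesis
          using f(2) c by (simp add: poly_ring_simps)
      qed
      have "(\<Sum>c \<in> C. Poly_Mapping.single (cell_degree c) 1 * f c) \<in> genideal ?T ?S"
        if "finite C" "C \<subseteq> cells 0" for C
        using that
      proof (induction C rule: finite_induct)
        case empty
        then show ?case
          using I.zero_closed by (simp add: poly_ring_simps)
      next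
        case (insert c C)
        then show ?case
          using I.a_closed[OF gen[of c]] by (simp add: poly_ring_simps)
      qed
      then show "g \<in> genideal ?T ?S"
        unfolding f(1) using finite_cells by blast
    qed
  qed
qed

theorem free_resolution_cube:
  "free_resolution V (cover_ideal V E :: ('v, 'k::field) mpoly set) cube_resolution"
  unfolding free_resolution_def dim_col_cube_resolution
proof (intro conjI allI)
  have deg: "Poly_Mapping.keys (cell_degree c) \<subseteq> V" if "c \<in> set (cell_list n)" for c n
    using that keys_cell_degree cell_cover_subset(1) unfolding cell_list(1) by blast
  have one: "1 = length [()]"
    by simp
  show "cube_resolution 0 \<in> poly_mat V 1 (length (cell_list 0))"
    unfolding cube_resolution.simps one by (rule homogenized_mat_poly_mat[OF deg])
  show "cube_resolution (Suc n) \<in> poly_mat V (length (cell_list n)) (length (cell_list (Suc n)))" for n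
    by (simp add: homogenized_mat_poly_mat[OF deg])
  show "{(cube_resolution 0 *\<^sub>v v) $ 0 | v. v \<in> poly_vec V (length (cell_list 0))} =
      (cover_ideal V E :: ('v, 'k) mpoly set)"
    unfolding image_augmentation cover_ideal_eq ..
qed (rule cube_resolution_exact)

lemma card_cells: "card (cells n) = (\<Sum>\<alpha> \<in> ideals. card (maxima \<alpha>) choose n)"
proof -
  have fin: "finite (maxima \<alpha>)" if "\<alpha> \<in> ideals" for \<alpha>
    using idealsD(2)[OF that] maxima_subset by (rule finite_subset[rotated])
  have "cells n = (SIGMA \<alpha>:ideals. {S. S \<subseteq> maxima \<alpha> \<and> card S = n})"
    by (auto simp: cells_def)
  then have "card (cells n) = (\<Sum>\<alpha> \<in> ideals. card {S. S \<subseteq> maxima \<alpha> \<and> card S = n})"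
    using fin finite_ideals by simp
  also have "\<dots> = (\<Sum>\<alpha> \<in> ideals. card (maxima \<alpha>) choose n)"
    using fin by (intro sum.cong refl n_subsets)
  finally show ?thesis .
qed

text \<open>The cube resolution serves twice: it witnesses that the choice in \<open>betti\<close>
  is among actual resolutions, and it is the minimal one whose rank gives the dimension of Tor for
  the chosen one.\<close>

theorem betti_cover_ideal:
  "betti V (cover_ideal V E :: ('v, 'k::field) mpoly set) i = (\<Sum>\<alpha> \<in> ideals. card (maxima \<alpha>) choose i)"
proof -
  have "free_resolution V (cover_ideal V E :: ('v, 'k) mpoly set)
      (SOME d. free_resolution V (cover_ideal V E :: ('v, 'k) mpoly set) d)"
    by (rule someI[of "free_resolution V (cover_ideal V E)", OF free_resolution_cube])
  then have "betti V (cover_ideal V E :: ('v, 'k) mpoly set) i =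
      dim_col (cube_resolution i :: ('v, 'k) mpoly mat)"
    unfolding betti_def by (rule dim_tor_eq_rank[OF _ free_resolution_cube residue_cube_resolution])
  also have "\<dots> = card (cells i)"
    using distinct_card[OF cell_list(2)[of i]] by (simp add: dim_col_cube_resolution cell_list(1))
  finally show ?thesis
    by (simp add: card_cells)
qed

end

section \<open>Transfer from positions in the labelling to the poset\<close>

theorem corollary3p12:
  fixes V :: "'v set" and E :: "'v set set"
    and P :: "'p set" and r :: "('p \<times> 'p) set" and n :: nat and p :: "nat \<Rightarrow> 'p"
    and i :: nat
  assumes "simple_graph V E"
    and "bipartite_graph V E"
    and "cohen_macaulay_graph TYPE('k::field) V E"
    and "finite P"
    and "partial_order_on P r"
    and "order_labelling P r n p"
    and "graph_isomorphic (CP2_verts n) (CP2_edges r n p) V E"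
  shows "betti V (cover_ideal V E :: ('v, 'k) mpoly set) i =
    (\<Sum>\<alpha> \<in> poset_ideals P r. card (max_elems r \<alpha>) choose i)"
proof -
  obtain \<phi> where \<phi>: "bij_betw \<phi> (CP2_verts n) V" "E = (\<lambda>e. \<phi> ` e) ` CP2_edges r n p"
    using assms(7) by (auto simp: graph_isomorphic_def)
  have p: "inj_on p {1..n}" "p ` {1..n} = P"
    and less: "\<And>a b. a \<in> {1..n} \<Longrightarrow> b \<in> {1..n} \<Longrightarrow> (p a, p b) \<in> r \<Longrightarrow> p a \<noteq> p b \<Longrightarrow> a < b"
    using assms(6) by (auto simp: order_labelling_def bij_betw_def)
  have r: "refl_on P r" "trans r"
    using assms(5) by (auto simp: partial_order_on_def preorder_on_def)
  have inj: "inj_on \<phi> ({1, 2} \<times> {1..n})" and V: "V = \<phi> ` ({1, 2} \<times> {1..n})"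
    using \<phi>(1) by (auto simp: bij_betw_def CP2_verts_def)
  have \<phi>_eq: "k = l \<and> a = b"
    if "\<phi> (k, a) = \<phi> (l, b)" "k \<in> {1, 2}" "l \<in> {1, 2}" "a \<in> {1..n}" "b \<in> {1..n}" for k l a b
    using inj_onD[OF inj that(1)] that by simp
  interpret cp2_graph "{1..n}" "\<lambda>a b. (p a, p b) \<in> r" "\<lambda>j. \<phi> (1, j)" "\<lambda>j. \<phi> (2, j)" V E
  proof
    show "finite {1..n}"
      by simp
    show "(p a, p a) \<in> r" if "a \<in> {1..n}" for a
      using that p(2) r(1) by (auto simp: refl_on_def)
    show "(p a, p c) \<in> r" if "(p a, p b) \<in> r" "(p b, p c) \<in> r" for a b c
      using that r(2) by (rule transD[rotated])
    show "a \<le> b" if "a \<in> {1..n}" "b \<in> {1..n}" "(p a, p b) \<in> r" for a b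
      \<comment> \<open>The labelling speaks of distinct elements only; if \<open>p a = p b\<close>,
        injectivity gives \<open>a = b\<close>.\<close>
      using less[OF that] inj_onD[OF p(1) _ that(1,2)] by fastforce
    show "inj_on (\<lambda>j. \<phi> (1, j)) {1..n}" "inj_on (\<lambda>j. \<phi> (2, j)) {1..n}"
      by (auto intro!: inj_onI dest!: \<phi>_eq)
    show "(\<lambda>j. \<phi> (1, j)) ` {1..n} \<inter> (\<lambda>j. \<phi> (2, j)) ` {1..n} = {}"
      by (auto dest!: \<phi>_eq)
    show "V = (\<lambda>j. \<phi> (1, j)) ` {1..n} \<union> (\<lambda>j. \<phi> (2, j)) ` {1..n}"
      unfolding V by auto
    show "E = {{\<phi> (1, a), \<phi> (2, b)} | a b. a \<in> {1..n} \<and> b \<in> {1..n} \<and> (p a, p b) \<in> r}"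
      unfolding \<phi>(2) CP2_edges_def image_Collect image_insert image_empty by blast
  qed
  have mx: "max_elems r (p ` \<alpha>) = p ` maxima \<alpha>" if "\<alpha> \<in> ideals" for \<alpha>
  proof -
    have "p b = p a \<longleftrightarrow> b = a" if "a \<in> \<alpha>" "b \<in> \<alpha>" for a b
      using inj_onD[OF p(1), of b a] that idealsD(1)[OF \<open>\<alpha> \<in> ideals\<close>] by blast
    then show ?thesis
      unfolding max_elems_def maxima_def by blast
  qed
  have "(\<Sum>\<alpha> \<in> poset_ideals P r. card (max_elems r \<alpha>) choose i) =
      (\<Sum>\<alpha> \<in> ideals. card (maxima \<alpha>) choose i)"
  \<comment> \<open>The members of \<open>ideals\<close> consist of positions and poset ideals of
    elements; image and preimage under \<open>p\<close> are inverse to each other and match the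
    maxima.\<close>
  proof (rule sum.reindex_bij_witness[of _ "\<lambda>\<alpha>. p ` \<alpha>" "\<lambda>\<alpha>. {a \<in> {1..n}. p a \<in> \<alpha>}"])
    fix \<alpha> assume \<alpha>: "\<alpha> \<in> poset_ideals P r"
    show "p ` {a \<in> {1..n}. p a \<in> \<alpha>} = \<alpha>"
      using \<alpha> p(2) by (auto simp: poset_ideals_def)
    show id: "{a \<in> {1..n}. p a \<in> \<alpha>} \<in> ideals"
      using \<alpha> p(2) unfolding poset_ideals_def ideals_def by blast
    have "max_elems r \<alpha> = p ` maxima {a \<in> {1..n}. p a \<in> \<alpha>}"
      using mx[OF id] \<open>p ` {a \<in> {1..n}. p a \<in> \<alpha>} = \<alpha>\<close> by simp
    moreover have "inj_on p (maxima {a \<in> {1..n}. p a \<in> \<alpha>})"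
      by (rule inj_on_subset[OF p(1) order_trans[OF maxima_subset]]) blast
    ultimately show "card (maxima {a \<in> {1..n}. p a \<in> \<alpha>}) choose i = card (max_elems r \<alpha>) choose i"
      by (simp add: card_image)
  next
    fix \<alpha> assume \<alpha>: "\<alpha> \<in> ideals"
    show "{a \<in> {1..n}. p a \<in> p ` \<alpha>} = \<alpha>"
      using idealsD(1)[OF \<alpha>] inj_onD[OF p(1)] by blast
    show "p ` \<alpha> \<in> poset_ideals P r"
      using \<alpha> p(2) unfolding poset_ideals_def ideals_def by blast
  qed
  then show ?thesis
    by (simp add: betti_cover_ideal)
qed

end
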